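(* Let $G$ be a higher pre-category, let $n>0$ and let $f$ be an $n$-cell of $G$. Then the following are equivalent: (i) $f$ has a bi-invertible structure; (ii) $f$ has a quasi-invertible structure; (iii) $f$ has a half-adjoint invertible structure. (Equivalence means that from each kind of structure on $f$ the others can be obtained; it is not claimed that these transformations are mutually inverse.)
   Context: **Globular sets.** The globe category $\mathbb G$ has the natural numbers as objects and morphisms generated by $\sigma_n,\tau_n:n\to n+1$ subject to $\sigma_{n+1}\circ\sigma_n=\tau_{n+1}\circ\sigma_n$ and $\sigma_{n+1}\circ\tau_n=\tau_{n+1}\circ\tau_n$. A globular set $G$ is a presheaf on $\mathbb G$; elements of $G(n)$ are $n$-cells, and for $n$-cells $x,y$ we write $f:x\to y$ for an $(n+1)$-cell $f$ with source $G(\sigma_n)(f)=x$ and target $G(\tau_n)(f)=y$. **Identities and composition.** A globular set with identities and composition is a globular set $G$ with, for each $n$-cell $x$, an $(n+1)$-cell $\mathrm{id}_x:x\to x$, and compositions defined inductively: given $n$-cells $f:x\to y$, $g:y\to z$ there is an $n$-cell $g\star_0 f:x\to z$; given $\alpha:f\to g$ and $\beta:h\to j$ such that $f\star_n h$ and $g\star_n j$ are well-defined, there is a cell $\alpha\star_{n+1}\beta:(f\star_n h)\to(g\star_n j)$. No equations are imposed. **Quasi-invertible structure (coinductive definition).** Let $G$ be a globular set with identities and composition. A quasi-invertible structure on an $n$-cell $f:x\to y$ ($n>0$) is a tuple $(f^{-1},f_R,f_L,f_R^{QI},f_L^{QI})$ where $f^{-1}:y\to x$ is an $n$-cell, $f_R: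 f\star_0 f^{-1}\to\mathrm{id}_y$ and $f_L:f^{-1}\star_0 f\to\mathrm{id}_x$ are $(n+1)$-cells, $f_R^{QI}$ is a quasi-invertible structure on $f_R$, and $f_L^{QI}$ is a quasi-invertible structure on $f_L$. **Hom globular sets.** For $n$-cells $x,y$ of $G$ with the same source and target (no condition if $n=0$), $G_{x,y}$ is the globular set whose $0$-cells are the $(n+1)$-cells of $G$ with source $x$ and target $y$, and whose $m$-cells are the $(n+m+1)$-cells of $G$ whose source and target are $(m-1)$-cells of $G_{x,y}$; it inherits identities and composition from $G$. **Graphical calculus.** The usual string diagrams for bicategories are used: areas represent $0$-cells, lines $1$-cells, nodes $2$-cells (read bottom to top, with $1$-cells composed by $\star_0$ placed side by side). A diagram represents a $2$-cell obtained by composing its constituents, with some bracketing and with unitors, associators and their inverses (below) inserted where needed. A globular set respects the graphical calculus if for any well-typed string diagram and any planar isotopy of it there is a $3$-cell from the $2$-cell represented by the source of the isotopy to the $2$-cell represented by its target, and this $3$-cell carries a quasi-invertible structure. **Higher pre-category.** A globular set $G$ with identities and composition such that $G$ and every $G_{x,y}$ respect the graphical calculus, together with the following cells, each equipped with a quasi-invertible structure: for $n>0$ and each $n$-cell $f:x\to y$, unitors $\lambda_f:\mathrm{id}_y\star_0 f\to f$ and $\rho_f:f\star_0\mathrm{id}_x\to f$; for composable $n$-cells $f,g,h$ with $n>0$, an associator $a_{f,g,h}:(f\star_0 g)\star_0 h\to f\star_0(g\star_0 h)$; for compatible cells $f,g,h,j$ and $n>0$, an interchanger $i_{f,g,h,j}:(f\star_n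 g)\star_0(h\star_n j)\to(f\star_0 h)\star_n(g\star_0 j)$; for suitable $f,g$ and $n$, a cell $\mathrm{id}_f\star_{n+1}\mathrm{id}_g\to\mathrm{id}_{f\star_n g}$. **Bi-invertible structure (coinductive definition).** For $n>0$, a bi-invertible structure on an $n$-cell $f:x\to y$ is a tuple $(f^\star,{}^\star f,f_R,f_L,f_R^{BI},f_L^{BI})$ where $f^\star:y\to x$ and ${}^\star f:y\to x$ are $n$-cells, $f_R:f\star_0 f^\star\to\mathrm{id}_y$ and $f_L:{}^\star f\star_0 f\to\mathrm{id}_x$ are $(n+1)$-cells, $f_R^{BI}$ is a bi-invertible structure on $f_R$, and $f_L^{BI}$ is a bi-invertible structure on $f_L$. **Half-adjoint invertible structure (coinductive definition).** For $n>0$, a half-adjoint invertible structure on an $n$-cell $f:x\to y$ is a tuple $(f',\alpha_f,\beta_f,\gamma_f,\alpha_f^{HAI},\beta_f^{HAI},\gamma_f^{HAI})$ where $f':y\to x$ is an $n$-cell; $\alpha_f:f\star_0 f'\to\mathrm{id}_y$ and $\beta_f:\mathrm{id}_x\to f'\star_0 f$ are $(n+1)$-cells; $\gamma_f$ is an $(n+2)$-cell from the composite $$f\xrightarrow{\rho_f^{-1}}f\star_0\mathrm{id}_x\xrightarrow{\mathrm{id}_f\star_1\beta_f}f\star_0(f'\star_0 f)\xrightarrow{a_{f,f',f}^{-1}}(f\star_0 f')\star_0 f\xrightarrow{\alpha_f\star_1\mathrm{id}_f}\mathrm{id}_y\star_0 f\xrightarrow{\lambda_f}f$$ (under $\star_0$,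 say bracketed as $\lambda_f\star_0((\alpha_f\star_1\mathrm{id}_f)\star_0(a_{f,f',f}^{-1}\star_0((\mathrm{id}_f\star_1\beta_f)\star_0\rho_f^{-1})))$, where $\rho_f^{-1}$ and $a^{-1}_{f,f',f}$ are the inverses in the given quasi-invertible structures) to $\mathrm{id}_f$; and $\alpha_f^{HAI},\beta_f^{HAI},\gamma_f^{HAI}$ are half-adjoint invertible structures on $\alpha_f,\beta_f,\gamma_f$ respectively. *)

theory Defs
  imports Main
begin

section \<open>Globular sets with identities and composition\<close>

text \<open>\<open>Src G n\<close> and \<open>Tgt G n\<close> map \<open>(n+1)\<close>-cells to \<open>n\<close>-cells: they are the actions of \<open>\<sigma>\<^sub>n\<close> and
  \<open>\<tau>\<^sub>n\<close>. The cells of all dimensions live in one type; \<open>Cells G m\<close> and \<open>Cells G n\<close> need not be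
  disjoint, so every operation carries the dimension of its arguments.\<close>

record 'c gset =
  Cells :: "nat \<Rightarrow> 'c set"
  Src :: "nat \<Rightarrow> 'c \<Rightarrow> 'c"
  Tgt :: "nat \<Rightarrow> 'c \<Rightarrow> 'c"

definition globular_set :: "('c, 'z) gset_scheme \<Rightarrow> bool" where
  "globular_set G \<longleftrightarrow>
     (\<forall>n. \<forall>f \<in> Cells G (Suc n). Src G n f \<in> Cells G n \<and> Tgt G n f \<in> Cells G n) \<and>
     (\<forall>n. \<forall>f \<in> Cells G (Suc (Suc n)).
        Src G n (Src G (Suc n) f) = Src G n (Tgt G (Suc n) f) \<and>
        Tgt G n (Src G (Suc n) f) = Tgt G n (Tgt G (Suc n) f))"

text \<open>\<open>arr G n f x y\<close>: \<open>f : x \<rightarrow> y\<close> is an \<open>(n+1)\<close>-cell between the \<open>n\<close>-cells \<open>x\<close> and \<open>y\<close>.\<close>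

definition arr :: "('c, 'z) gset_scheme \<Rightarrow> nat \<Rightarrow> 'c \<Rightarrow> 'c \<Rightarrow> 'c \<Rightarrow> bool" where
  "arr G n f x y \<longleftrightarrow> f \<in> Cells G (Suc n) \<and> Src G n f = x \<and> Tgt G n f = y"

definition parallel :: "('c, 'z) gset_scheme \<Rightarrow> nat \<Rightarrow> 'c \<Rightarrow> 'c \<Rightarrow> bool" where
  "parallel G n x y \<longleftrightarrow> x \<in> Cells G n \<and> y \<in> Cells G n \<and>
     (\<forall>m. n = Suc m \<longrightarrow> Src G m x = Src G m y \<and> Tgt G m x = Tgt G m y)"

text \<open>\<open>Ident G n x\<close> is \<open>id\<^sub>x\<close> for an \<open>n\<close>-cell \<open>x\<close>, and \<open>Comp G n k f g\<close> is \<open>f \<star>\<^sub>k g\<close> for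
  \<open>n\<close>-cells \<open>f\<close>, \<open>g\<close>, in applicative order. The index \<open>k\<close> is a codimension: \<open>\<star>\<^sub>k\<close> composes along a
  common boundary of dimension \<open>n - k - 1\<close>.\<close>

record 'c gset_ic = "'c gset" +
  Ident :: "nat \<Rightarrow> 'c \<Rightarrow> 'c"
  Comp :: "nat \<Rightarrow> nat \<Rightarrow> 'c \<Rightarrow> 'c \<Rightarrow> 'c"

text \<open>\<open>composable G n k f g\<close>: the composite \<open>f \<star>\<^sub>k g\<close> of \<open>n\<close>-cells is well-defined.\<close>

inductive composable :: "('c, 'z) gset_scheme \<Rightarrow> nat \<Rightarrow> nat \<Rightarrow> 'c \<Rightarrow> 'c \<Rightarrow> bool"
  for G :: "('c, 'z) gset_scheme" where
  composable_0:
    "arr G n f x y \<Longrightarrow> arr G n g y z \<Longrightarrow> composable G (Suc n) 0 g f"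
| composable_Suc:
    "arr G n \<alpha> f g \<Longrightarrow> arr G n \<beta> h j \<Longrightarrow> composable G n k f h \<Longrightarrow> composable G n k g j \<Longrightarrow>
     composable G (Suc n) (Suc k) \<alpha> \<beta>"

definition globular_set_ic :: "('c, 'z) gset_ic_scheme \<Rightarrow> bool" where
  "globular_set_ic G \<longleftrightarrow> globular_set G \<and>
     (\<forall>n. \<forall>x \<in> Cells G n. arr G n (Ident G n x) x x) \<and>
     (\<forall>n f g x y z. arr G n f x y \<longrightarrow> arr G n g y z \<longrightarrow> arr G n (Comp G (Suc n) 0 g f) x z) \<and>
     (\<forall>n k \<alpha> \<beta> f g h j. arr G n \<alpha> f g \<longrightarrow> arr G n \<beta> h j \<longrightarrow>
        composable G n k f h \<longrightarrow> composable G n k g j \<longrightarrow>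
        arr G n (Comp G (Suc n) (Suc k) \<alpha> \<beta>) (Comp G n k f h) (Comp G n k g j))"


section \<open>Quasi-invertible and bi-invertible structures\<close>

text \<open>The possibly infinite trees of data of a structure form a codatatype; a coinductive predicate
  singles out those trees that are a structure on a given cell.\<close>

codatatype 'c qi =
  QI (qi_inv: 'c) (qi_R: 'c) (qi_L: 'c) (qi_R_QI: "'c qi") (qi_L_QI: "'c qi")

coinductive qi_structure :: "('c, 'z) gset_ic_scheme \<Rightarrow> nat \<Rightarrow> 'c qi \<Rightarrow> 'c \<Rightarrow> bool"
  for G :: "('c, 'z) gset_ic_scheme" where
  "arr G n f x y \<Longrightarrow>
   arr G n f' y x \<Longrightarrow>
   arr G (Suc n) fR (Comp G (Suc n) 0 f f') (Ident G n y) \<Longrightarrow>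
   arr G (Suc n) fL (Comp G (Suc n) 0 f' f) (Ident G n x) \<Longrightarrow>
   qi_structure G (Suc (Suc n)) sR fR \<Longrightarrow>
   qi_structure G (Suc (Suc n)) sL fL \<Longrightarrow>
   qi_structure G (Suc n) (QI f' fR fL sR sL) f"

codatatype 'c bi =
  BI (bi_rinv: 'c) (bi_linv: 'c) (bi_R: 'c) (bi_L: 'c) (bi_R_BI: "'c bi") (bi_L_BI: "'c bi")

coinductive bi_structure :: "('c, 'z) gset_ic_scheme \<Rightarrow> nat \<Rightarrow> 'c bi \<Rightarrow> 'c \<Rightarrow> bool"
  for G :: "('c, 'z) gset_ic_scheme" where
  "arr G n f x y \<Longrightarrow>
   arr G n fr y x \<Longrightarrow>
   arr G n fl y x \<Longrightarrow>
   arr G (Suc n) fR (Comp G (Suc n) 0 f fr) (Ident G n y) \<Longrightarrow>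
   arr G (Suc n) fL (Comp G (Suc n) 0 fl f) (Ident G n x) \<Longrightarrow>
   bi_structure G (Suc (Suc n)) sR fR \<Longrightarrow>
   bi_structure G (Suc (Suc n)) sL fL \<Longrightarrow>
   bi_structure G (Suc n) (BI fr fl fR fL sR sL) f"


section \<open>The cells of a higher pre-category\<close>

text \<open>The dimension argument of each operation is that of the cells it is applied to, so that
  \<open>LUnit G n f\<close> is an \<open>(n+1)\<close>-cell for an \<open>n\<close>-cell \<open>f\<close>. In \<open>Ichg G m n f g h j\<close> the cells have
  dimension \<open>m\<close>, and \<open>n\<close> is the index of the composition interchanged with \<open>\<star>\<^sub>0\<close>; in \<open>IdComp G n k f g\<close>
  the cells have dimension \<open>n\<close> and \<open>k\<close> is the index of the composition.\<close>

record 'c precat = "'c gset_ic" +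
  LUnit :: "nat \<Rightarrow> 'c \<Rightarrow> 'c"
  LUnit_QI :: "nat \<Rightarrow> 'c \<Rightarrow> 'c qi"
  RUnit :: "nat \<Rightarrow> 'c \<Rightarrow> 'c"
  RUnit_QI :: "nat \<Rightarrow> 'c \<Rightarrow> 'c qi"
  Assoc :: "nat \<Rightarrow> 'c \<Rightarrow> 'c \<Rightarrow> 'c \<Rightarrow> 'c"
  Assoc_QI :: "nat \<Rightarrow> 'c \<Rightarrow> 'c \<Rightarrow> 'c \<Rightarrow> 'c qi"
  Ichg :: "nat \<Rightarrow> nat \<Rightarrow> 'c \<Rightarrow> 'c \<Rightarrow> 'c \<Rightarrow> 'c \<Rightarrow> 'c"
  Ichg_QI :: "nat \<Rightarrow> nat \<Rightarrow> 'c \<Rightarrow> 'c \<Rightarrow> 'c \<Rightarrow> 'c \<Rightarrow> 'c qi"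
  IdComp :: "nat \<Rightarrow> nat \<Rightarrow> 'c \<Rightarrow> 'c \<Rightarrow> 'c"
  IdComp_QI :: "nat \<Rightarrow> nat \<Rightarrow> 'c \<Rightarrow> 'c \<Rightarrow> 'c qi"

definition has_unitors :: "'c precat \<Rightarrow> bool" where
  "has_unitors G \<longleftrightarrow> (\<forall>n f x y. arr G n f x y \<longrightarrow>
     arr G (Suc n) (LUnit G (Suc n) f) (Comp G (Suc n) 0 (Ident G n y) f) f \<and>
     qi_structure G (Suc (Suc n)) (LUnit_QI G (Suc n) f) (LUnit G (Suc n) f) \<and>
     arr G (Suc n) (RUnit G (Suc n) f) (Comp G (Suc n) 0 f (Ident G n x)) f \<and>
     qi_structure G (Suc (Suc n)) (RUnit_QI G (Suc n) f) (RUnit G (Suc n) f))"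

definition has_associators :: "'c precat \<Rightarrow> bool" where
  "has_associators G \<longleftrightarrow> (\<forall>n f g h. composable G n 0 f g \<longrightarrow> composable G n 0 g h \<longrightarrow>
     arr G n (Assoc G n f g h) (Comp G n 0 (Comp G n 0 f g) h) (Comp G n 0 f (Comp G n 0 g h)) \<and>
     qi_structure G (Suc n) (Assoc_QI G n f g h) (Assoc G n f g h))"

text \<open>Compatibility of \<open>f\<close>, \<open>g\<close>, \<open>h\<close>, \<open>j\<close> means that both sides of the interchanger are well-defined;
  for \<open>n > 0\<close> the outer composites exist as soon as the inner ones do.\<close>

definition has_interchangers :: "'c precat \<Rightarrow> bool" where
  "has_interchangers G \<longleftrightarrow> (\<forall>m n f g h j. n > 0 \<longrightarrow>
     composable G m n f g \<longrightarrow> composable G m n h j \<longrightarrow>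
     composable G m 0 f h \<longrightarrow> composable G m 0 g j \<longrightarrow>
     arr G m (Ichg G m n f g h j)
       (Comp G m 0 (Comp G m n f g) (Comp G m n h j))
       (Comp G m n (Comp G m 0 f h) (Comp G m 0 g j)) \<and>
     qi_structure G (Suc m) (Ichg_QI G m n f g h j) (Ichg G m n f g h j))"

definition has_id_comps :: "'c precat \<Rightarrow> bool" where
  "has_id_comps G \<longleftrightarrow> (\<forall>n k f g. composable G n k f g \<longrightarrow>
     arr G (Suc n) (IdComp G n k f g)
       (Comp G (Suc n) (Suc k) (Ident G n f) (Ident G n g)) (Ident G n (Comp G n k f g)) \<and>
     qi_structure G (Suc (Suc n)) (IdComp_QI G n k f g) (IdComp G n k f g))"


section \<open>Hom globular sets\<close>

primrec hom_cells :: "('c, 'z) gset_scheme \<Rightarrow> nat \<Rightarrow> 'c \<Rightarrow> 'c \<Rightarrow> nat \<Rightarrow> 'c set" where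
  "hom_cells G n x y 0 = {f. arr G n f x y}"
| "hom_cells G n x y (Suc m) =
     {f \<in> Cells G (n + Suc m + 1).
        Src G (n + m + 1) f \<in> hom_cells G n x y m \<and> Tgt G (n + m + 1) f \<in> hom_cells G n x y m}"

text \<open>Compositions are indexed by codimension, so the index \<open>k\<close> of \<open>\<star>\<^sub>k\<close> is not shifted.\<close>

definition hom :: "'c precat \<Rightarrow> nat \<Rightarrow> 'c \<Rightarrow> 'c \<Rightarrow> 'c precat" where
  "hom G n x y = \<lparr>
     Cells = hom_cells G n x y,
     Src = (\<lambda>m. Src G (n + m + 1)),
     Tgt = (\<lambda>m. Tgt G (n + m + 1)),
     Ident = (\<lambda>m. Ident G (n + m + 1)),
     Comp = (\<lambda>m. Comp G (n + m + 1)),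
     LUnit = (\<lambda>m. LUnit G (n + m + 1)),
     LUnit_QI = (\<lambda>m. LUnit_QI G (n + m + 1)),
     RUnit = (\<lambda>m. RUnit G (n + m + 1)),
     RUnit_QI = (\<lambda>m. RUnit_QI G (n + m + 1)),
     Assoc = (\<lambda>m. Assoc G (n + m + 1)),
     Assoc_QI = (\<lambda>m. Assoc_QI G (n + m + 1)),
     Ichg = (\<lambda>m. Ichg G (n + m + 1)),
     Ichg_QI = (\<lambda>m. Ichg_QI G (n + m + 1)),
     IdComp = (\<lambda>m. IdComp G (n + m + 1)),
     IdComp_QI = (\<lambda>m. IdComp_QI G (n + m + 1)) \<rparr>"


section \<open>The graphical calculus\<close>

text \<open>A horizontal slice of a string diagram is a word of wires, read from left to right; \<open>[f, g]\<close>
  stands for a composite \<open>f \<star>\<^sub>0 g\<close>. A bracketed word also records where identity \<open>1\<close>-cells, which are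
  not drawn, are inserted: \<open>Blank x\<close> is an empty piece of the area \<open>x\<close>.\<close>

datatype 'c bracketing = Blank 'c | Wire 'c | Beside "'c bracketing" "'c bracketing"

primrec wires :: "'c bracketing \<Rightarrow> 'c list" where
  "wires (Blank x) = []"
| "wires (Wire f) = [f]"
| "wires (Beside b c) = wires b @ wires c"

primrec composite :: "('c, 'z) gset_ic_scheme \<Rightarrow> 'c bracketing \<Rightarrow> 'c" where
  "composite G (Blank x) = Ident G 0 x"
| "composite G (Wire f) = f"
| "composite G (Beside b c) = Comp G 1 0 (composite G b) (composite G c)"

primrec well_typed :: "('c, 'z) gset_ic_scheme \<Rightarrow> 'c bracketing \<Rightarrow> bool" where
  "well_typed G (Blank x) \<longleftrightarrow> x \<in> Cells G 0"
| "well_typed G (Wire f) \<longleftrightarrow> f \<in> Cells G 1"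
| "well_typed G (Beside b c) \<longleftrightarrow>
     well_typed G b \<and> well_typed G c \<and> composable G 1 0 (composite G b) (composite G c)"

text \<open>A node is a \<open>2\<close>-cell together with the way its source and target are drawn as words of wires
  entering from below and leaving above.\<close>

datatype 'c node = Node (node_in: "'c bracketing") (node_cell: 'c) (node_out: "'c bracketing")

abbreviation ins :: "'c node \<Rightarrow> 'c list" where "ins a \<equiv> wires (node_in a)"
abbreviation outs :: "'c node \<Rightarrow> 'c list" where "outs a \<equiv> wires (node_out a)"

text \<open>A diagram in general position (no two nodes at the same height) is cut into horizontal layers,
  listed from bottom to top. A layer \<open>(u, a, v)\<close> consists of one node \<open>a\<close>, the vertical wires \<open>u\<close> to
  its left and the vertical wires \<open>v\<close> to its right. Wires of string diagrams for bicategories run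
  upwards, so along a planar isotopy the layers change exactly when two nodes, with none of the wires
  of one attached to the other, pass each other's height.\<close>

type_synonym 'c diagram = "('c list \<times> 'c node \<times> 'c list) list"

inductive exchange :: "'c diagram \<Rightarrow> 'c diagram \<Rightarrow> bool" where
  "exchange
     (D @ [(u, a, w @ ins b @ v), (u @ outs a @ w, b, v)] @ E)
     (D @ [(u @ ins a @ w, b, v), (u, a, w @ outs b @ v)] @ E)"

definition isotopic :: "'c diagram \<Rightarrow> 'c diagram \<Rightarrow> bool" where
  "isotopic = equivclp exchange"

definition juxtapose :: "'c list \<Rightarrow> 'c diagram \<Rightarrow> 'c list \<Rightarrow> 'c diagram" where
  "juxtapose l D r = map (\<lambda>(u, a, v). (l @ u, a, v @ r)) D"

text \<open>\<open>represents G D b c t\<close>: the \<open>2\<close>-cell \<open>t\<close>, from the composite of \<open>b\<close> to that of \<open>c\<close>, is obtained by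
  composing the constituents of \<open>D\<close> with some bracketing, with unitors, associators and their inverses
  inserted. Intermediate words are matched as bracketings and not merely as \<open>1\<close>-cells, since
  differently bracketed composites may happen to be equal as cells. Two diagrams side by side are put
  in general position by drawing the nodes of the left one below those of the right one.\<close>

inductive represents ::
    "'c precat \<Rightarrow> 'c diagram \<Rightarrow> 'c bracketing \<Rightarrow> 'c bracketing \<Rightarrow> 'c \<Rightarrow> bool"
  for G :: "'c precat" where
  rep_wires:
    "well_typed G b \<Longrightarrow> represents G [] b b (Ident G 1 (composite G b))"
| rep_node:
    "well_typed G b \<Longrightarrow> well_typed G c \<Longrightarrow> arr G 1 t (composite G b) (composite G c) \<Longrightarrow>
     represents G [([], Node b t c, [])] b c t"
| rep_above:
    "represents G D b c s \<Longrightarrow> represents G E c d t \<Longrightarrow>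
     represents G (D @ E) b d (Comp G 2 0 t s)"
| rep_beside:
    "represents G D b c s \<Longrightarrow> represents G E b' c' t \<Longrightarrow> well_typed G (Beside b b') \<Longrightarrow>
     represents G (juxtapose [] D (wires b') @ juxtapose (wires c) E [])
       (Beside b b') (Beside c c') (Comp G 2 1 s t)"
| rep_left_unitor:
    "well_typed G (Beside (Blank y) b) \<Longrightarrow>
     represents G [] (Beside (Blank y) b) b (LUnit G 1 (composite G b))"
| rep_left_unitor_inv:
    "well_typed G (Beside (Blank y) b) \<Longrightarrow>
     represents G [] b (Beside (Blank y) b) (qi_inv (LUnit_QI G 1 (composite G b)))"
| rep_right_unitor:
    "well_typed G (Beside b (Blank x)) \<Longrightarrow>
     represents G [] (Beside b (Blank x)) b (RUnit G 1 (composite G b))"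
| rep_right_unitor_inv:
    "well_typed G (Beside b (Blank x)) \<Longrightarrow>
     represents G [] b (Beside b (Blank x)) (qi_inv (RUnit_QI G 1 (composite G b)))"
| rep_associator:
    "well_typed G (Beside (Beside b c) d) \<Longrightarrow>
     represents G [] (Beside (Beside b c) d) (Beside b (Beside c d))
       (Assoc G 1 (composite G b) (composite G c) (composite G d))"
| rep_associator_inv:
    "well_typed G (Beside (Beside b c) d) \<Longrightarrow>
     represents G [] (Beside b (Beside c d)) (Beside (Beside b c) d)
       (qi_inv (Assoc_QI G 1 (composite G b) (composite G c) (composite G d)))"

definition respects_graphical_calculus :: "'c precat \<Rightarrow> bool" where
  "respects_graphical_calculus G \<longleftrightarrow> (\<forall>D E b c s t.
     isotopic D E \<longrightarrow> represents G D b c s \<longrightarrow> represents G E b c t \<longrightarrow>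
     (\<exists>h S. arr G 2 h s t \<and> qi_structure G 3 S h))"


section \<open>Higher pre-categories and half-adjoint invertible structures\<close>

definition higher_precategory :: "'c precat \<Rightarrow> bool" where
  "higher_precategory G \<longleftrightarrow>
     globular_set_ic G \<and>
     respects_graphical_calculus G \<and>
     (\<forall>n x y. parallel G n x y \<longrightarrow> respects_graphical_calculus (hom G n x y)) \<and>
     has_unitors G \<and> has_associators G \<and> has_interchangers G \<and> has_id_comps G"

text \<open>For \<open>n\<close>-cells \<open>f : x \<rightarrow> y\<close> and \<open>f' : y \<rightarrow> x\<close>, \<open>\<alpha> : f \<star>\<^sub>0 f' \<rightarrow> id\<^sub>y\<close> and \<open>\<beta> : id\<^sub>x \<rightarrow> f' \<star>\<^sub>0 f\<close>.\<close>

definition zigzag :: "'c precat \<Rightarrow> nat \<Rightarrow> 'c \<Rightarrow> 'c \<Rightarrow> 'c \<Rightarrow> 'c \<Rightarrow> 'c" where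
  "zigzag G n f f' \<alpha> \<beta> =
     Comp G (Suc n) 0 (LUnit G n f)
       (Comp G (Suc n) 0 (Comp G (Suc n) 1 \<alpha> (Ident G n f))
         (Comp G (Suc n) 0 (qi_inv (Assoc_QI G n f f' f))
           (Comp G (Suc n) 0 (Comp G (Suc n) 1 (Ident G n f) \<beta>)
             (qi_inv (RUnit_QI G n f)))))"

codatatype 'c hai =
  HAI (hai_inv: 'c) (hai_\<alpha>: 'c) (hai_\<beta>: 'c) (hai_\<gamma>: 'c)
      (hai_\<alpha>_HAI: "'c hai") (hai_\<beta>_HAI: "'c hai") (hai_\<gamma>_HAI: "'c hai")

coinductive hai_structure :: "'c precat \<Rightarrow> nat \<Rightarrow> 'c hai \<Rightarrow> 'c \<Rightarrow> bool"
  for G :: "'c precat" where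
  "arr G n f x y \<Longrightarrow>
   arr G n f' y x \<Longrightarrow>
   arr G (Suc n) \<alpha> (Comp G (Suc n) 0 f f') (Ident G n y) \<Longrightarrow>
   arr G (Suc n) \<beta> (Ident G n x) (Comp G (Suc n) 0 f' f) \<Longrightarrow>
   arr G (Suc (Suc n)) \<gamma> (zigzag G (Suc n) f f' \<alpha> \<beta>) (Ident G (Suc n) f) \<Longrightarrow>
   hai_structure G (Suc (Suc n)) s\<^sub>\<alpha> \<alpha> \<Longrightarrow>
   hai_structure G (Suc (Suc n)) s\<^sub>\<beta> \<beta> \<Longrightarrow>
   hai_structure G (Suc (Suc (Suc n))) s\<^sub>\<gamma> \<gamma> \<Longrightarrow>
   hai_structure G (Suc n) (HAI f' \<alpha> \<beta> \<gamma> s\<^sub>\<alpha> s\<^sub>\<beta> s\<^sub>\<gamma>) f"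

end

theory Submission
  imports Defs
begin

text \<open>Every quasi-invertible cell is bi-invertible. Conversely, the closure of the bi-invertible cells
  under right inverses and all compositions is a post-fixed point of the quasi-invertibility operator:
  the inverse laws of a composite are obtained by composing associators, unitors, interchangers and
  whiskered inverse laws, all of which lie in the closure. Hence both notions coincide with the closure
  and are stable under composition.

  In a half-adjoint structure the inverse of \<open>\<beta>\<close> serves as the missing inverse law, so the half-adjoint
  invertible cells together with their chosen inverses support quasi-invertible structures. For the
  converse let \<open>\<epsilon> : f \<cdot> g \<rightarrow> id\<close> and \<open>\<theta> : g \<cdot> f \<rightarrow> id\<close> be the inverse laws of \<open>f\<close>, with inverses \<open>\<epsilon>'\<close> and \<open>\<eta>\<close>.
  Put \<open>\<alpha> = \<epsilon> \<circ> (f \<theta> g) \<circ> (\<epsilon>' f g)\<close> and \<open>\<beta> = \<eta>\<close>. Two exchanges turn the diagram of the zigzag into that of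
  \<open>(\<epsilon> f) \<circ> (f \<eta>) \<circ> (f \<theta>) \<circ> (\<epsilon>' f)\<close>, which cancels to the identity; the resulting \<open>\<gamma>\<close> is again
  quasi-invertible, so one can continue coinductively.\<close>

section \<open>Coinduction principles\<close>

definition quasi_invertible :: "('c, 'z) gset_ic_scheme \<Rightarrow> nat \<Rightarrow> 'c \<Rightarrow> bool" where
  "quasi_invertible G n f \<longleftrightarrow> (\<exists>S. qi_structure G n S f)"

definition bi_invertible :: "('c, 'z) gset_ic_scheme \<Rightarrow> nat \<Rightarrow> 'c \<Rightarrow> bool" where
  "bi_invertible G n f \<longleftrightarrow> (\<exists>S. bi_structure G n S f)"

definition half_adjoint_invertible :: "'c precat \<Rightarrow> nat \<Rightarrow> 'c \<Rightarrow> bool" where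
  "half_adjoint_invertible G n f \<longleftrightarrow> (\<exists>S. hai_structure G n S f)"

primcorec qi_unfold ::
    "(nat \<Rightarrow> 'c \<Rightarrow> 'c) \<Rightarrow> (nat \<Rightarrow> 'c \<Rightarrow> 'c) \<Rightarrow> (nat \<Rightarrow> 'c \<Rightarrow> 'c) \<Rightarrow> nat \<Rightarrow> 'c \<Rightarrow> 'c qi" where
  "qi_unfold i r l n f =
     QI (i n f) (r n f) (l n f) (qi_unfold i r l (Suc n) (r n f)) (qi_unfold i r l (Suc n) (l n f))"

primcorec bi_unfold ::
    "(nat \<Rightarrow> 'c \<Rightarrow> 'c) \<Rightarrow> (nat \<Rightarrow> 'c \<Rightarrow> 'c) \<Rightarrow> (nat \<Rightarrow> 'c \<Rightarrow> 'c) \<Rightarrow> (nat \<Rightarrow> 'c \<Rightarrow> 'c) \<Rightarrow>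
     nat \<Rightarrow> 'c \<Rightarrow> 'c bi" where
  "bi_unfold i j r l n f =
     BI (i n f) (j n f) (r n f) (l n f)
       (bi_unfold i j r l (Suc n) (r n f)) (bi_unfold i j r l (Suc n) (l n f))"

primcorec hai_unfold ::
    "(nat \<Rightarrow> 'c \<Rightarrow> 'c) \<Rightarrow> (nat \<Rightarrow> 'c \<Rightarrow> 'c) \<Rightarrow> (nat \<Rightarrow> 'c \<Rightarrow> 'c) \<Rightarrow> (nat \<Rightarrow> 'c \<Rightarrow> 'c) \<Rightarrow>
     nat \<Rightarrow> 'c \<Rightarrow> 'c hai" where
  "hai_unfold i a b c n f =
     HAI (i n f) (a n f) (b n f) (c n f)
       (hai_unfold i a b c (Suc n) (a n f)) (hai_unfold i a b c (Suc n) (b n f))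
       (hai_unfold i a b c (Suc (Suc n)) (c n f))"

lemma quasi_invertible_coinduct:
  assumes X: "X n f"
    and step: "\<And>n f. X n f \<Longrightarrow> \<exists>m x y f' R L. n = Suc m \<and> arr G m f x y \<and> arr G m f' y x \<and>
      arr G (Suc m) R (Comp G (Suc m) 0 f f') (Ident G m y) \<and>
      arr G (Suc m) L (Comp G (Suc m) 0 f' f) (Ident G m x) \<and>
      X (Suc n) R \<and> X (Suc n) L"
  shows "quasi_invertible G n f"
proof -
  have "\<forall>n f. \<exists>f' R L. X n f \<longrightarrow> (\<exists>m x y. n = Suc m \<and> arr G m f x y \<and> arr G m f' y x \<and>
      arr G (Suc m) R (Comp G (Suc m) 0 f f') (Ident G m y) \<and>
      arr G (Suc m) L (Comp G (Suc m) 0 f' f) (Ident G m x) \<and>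
      X (Suc n) R \<and> X (Suc n) L)"
    using step by blast
  then obtain i r l where irl: "\<And>n f. X n f \<Longrightarrow> \<exists>m x y. n = Suc m \<and> arr G m f x y \<and>
      arr G m (i n f) y x \<and>
      arr G (Suc m) (r n f) (Comp G (Suc m) 0 f (i n f)) (Ident G m y) \<and>
      arr G (Suc m) (l n f) (Comp G (Suc m) 0 (i n f) f) (Ident G m x) \<and>
      X (Suc n) (r n f) \<and> X (Suc n) (l n f)"
    by metis
  have "S = qi_unfold i r l n f \<and> X n f \<Longrightarrow> qi_structure G n S f" for S n f
  proof (coinduction arbitrary: S n f)
    case qi_structure
    then obtain m where "n = Suc m" using irl by blast
    with qi_structure irl[of n f] show ?case
      by (subst (asm) qi_unfold.code) auto
  qed
  with X show ?thesis unfolding quasi_invertible_def by blast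
qed

lemma bi_invertible_coinduct:
  assumes X: "X n f"
    and step: "\<And>n f. X n f \<Longrightarrow> \<exists>m x y f' f'' R L. n = Suc m \<and> arr G m f x y \<and>
      arr G m f' y x \<and> arr G m f'' y x \<and>
      arr G (Suc m) R (Comp G (Suc m) 0 f f') (Ident G m y) \<and>
      arr G (Suc m) L (Comp G (Suc m) 0 f'' f) (Ident G m x) \<and>
      X (Suc n) R \<and> X (Suc n) L"
  shows "bi_invertible G n f"
proof -
  have "\<forall>n f. \<exists>f' f'' R L. X n f \<longrightarrow> (\<exists>m x y. n = Suc m \<and> arr G m f x y \<and>
      arr G m f' y x \<and> arr G m f'' y x \<and>
      arr G (Suc m) R (Comp G (Suc m) 0 f f') (Ident G m y) \<and>
      arr G (Suc m) L (Comp G (Suc m) 0 f'' f) (Ident G m x) \<and>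
      X (Suc n) R \<and> X (Suc n) L)"
    using step by blast
  then obtain i j r l where ijrl: "\<And>n f. X n f \<Longrightarrow> \<exists>m x y. n = Suc m \<and> arr G m f x y \<and>
      arr G m (i n f) y x \<and> arr G m (j n f) y x \<and>
      arr G (Suc m) (r n f) (Comp G (Suc m) 0 f (i n f)) (Ident G m y) \<and>
      arr G (Suc m) (l n f) (Comp G (Suc m) 0 (j n f) f) (Ident G m x) \<and>
      X (Suc n) (r n f) \<and> X (Suc n) (l n f)"
    by metis
  have "S = bi_unfold i j r l n f \<and> X n f \<Longrightarrow> bi_structure G n S f" for S n f
  proof (coinduction arbitrary: S n f)
    case bi_structure
    then obtain m where "n = Suc m" using ijrl by blast
    with bi_structure ijrl[of n f] show ?case
      by (subst (asm) bi_unfold.code) auto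
  qed
  with X show ?thesis unfolding bi_invertible_def by blast
qed

lemma half_adjoint_invertible_coinduct:
  assumes X: "X n f"
    and step: "\<And>n f. X n f \<Longrightarrow> \<exists>m x y f' \<alpha> \<beta> \<gamma>. n = Suc m \<and> arr G m f x y \<and> arr G m f' y x \<and>
      arr G (Suc m) \<alpha> (Comp G (Suc m) 0 f f') (Ident G m y) \<and>
      arr G (Suc m) \<beta> (Ident G m x) (Comp G (Suc m) 0 f' f) \<and>
      arr G (Suc (Suc m)) \<gamma> (zigzag G (Suc m) f f' \<alpha> \<beta>) (Ident G (Suc m) f) \<and>
      X (Suc n) \<alpha> \<and> X (Suc n) \<beta> \<and> X (Suc (Suc n)) \<gamma>"
  shows "half_adjoint_invertible G n f"
proof -
  have "\<forall>n f. \<exists>f' \<alpha> \<beta> \<gamma>. X n f \<longrightarrow> (\<exists>m x y. n = Suc m \<and> arr G m f x y \<and> arr G m f' y x \<and>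
      arr G (Suc m) \<alpha> (Comp G (Suc m) 0 f f') (Ident G m y) \<and>
      arr G (Suc m) \<beta> (Ident G m x) (Comp G (Suc m) 0 f' f) \<and>
      arr G (Suc (Suc m)) \<gamma> (zigzag G (Suc m) f f' \<alpha> \<beta>) (Ident G (Suc m) f) \<and>
      X (Suc n) \<alpha> \<and> X (Suc n) \<beta> \<and> X (Suc (Suc n)) \<gamma>)"
    using step by blast
  then obtain i a b c where iabc: "\<And>n f. X n f \<Longrightarrow> \<exists>m x y. n = Suc m \<and> arr G m f x y \<and>
      arr G m (i n f) y x \<and>
      arr G (Suc m) (a n f) (Comp G (Suc m) 0 f (i n f)) (Ident G m y) \<and>
      arr G (Suc m) (b n f) (Ident G m x) (Comp G (Suc m) 0 (i n f) f) \<and>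
      arr G (Suc (Suc m)) (c n f) (zigzag G (Suc m) f (i n f) (a n f) (b n f))
        (Ident G (Suc m) f) \<and>
      X (Suc n) (a n f) \<and> X (Suc n) (b n f) \<and> X (Suc (Suc n)) (c n f)"
    by metis
  have "S = hai_unfold i a b c n f \<and> X n f \<Longrightarrow> hai_structure G n S f" for S n f
  proof (coinduction arbitrary: S n f)
    case hai_structure
    then obtain m where "n = Suc m" using iabc by blast
    with hai_structure iabc[of n f] show ?case
      by (subst (asm) hai_unfold.code) auto
  qed
  with X show ?thesis unfolding half_adjoint_invertible_def by blast
qed

lemma arr_unique: "arr G n f x y \<Longrightarrow> arr G n f x' y' \<Longrightarrow> x' = x \<and> y' = y"
  by (auto simp: arr_def)

lemma quasi_invertible_imp_bi_invertible:
  "quasi_invertible G n f \<Longrightarrow> bi_invertible G n f"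
proof (erule bi_invertible_coinduct[where X = "quasi_invertible G"])
  fix n f assume "quasi_invertible G n f"
  then obtain S where "qi_structure G n S f" by (auto simp: quasi_invertible_def)
  then show "\<exists>m x y f' f'' R L. n = Suc m \<and> arr G m f x y \<and>
      arr G m f' y x \<and> arr G m f'' y x \<and>
      arr G (Suc m) R (Comp G (Suc m) 0 f f') (Ident G m y) \<and>
      arr G (Suc m) L (Comp G (Suc m) 0 f'' f) (Ident G m x) \<and>
      quasi_invertible G (Suc n) R \<and> quasi_invertible G (Suc n) L"
    unfolding quasi_invertible_def by cases blast
qed

lemma bi_invertibleE:
  assumes "bi_invertible G n f"
  obtains m x y f' f'' R L where "n = Suc m" "arr G m f x y" "arr G m f' y x" "arr G m f'' y x"
    "arr G (Suc m) R (Comp G (Suc m) 0 f f') (Ident G m y)"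
    "arr G (Suc m) L (Comp G (Suc m) 0 f'' f) (Ident G m x)"
    "bi_invertible G (Suc n) R" "bi_invertible G (Suc n) L"
proof -
  from assms obtain S where "bi_structure G n S f" by (auto simp: bi_invertible_def)
  then show thesis using that unfolding bi_invertible_def by cases blast
qed

lemma bi_invertible_arrE:
  assumes "bi_invertible G (Suc n) f" "arr G n f x y"
  obtains f' f'' R L where "arr G n f' y x" "arr G n f'' y x"
    "arr G (Suc n) R (Comp G (Suc n) 0 f f') (Ident G n y)"
    "arr G (Suc n) L (Comp G (Suc n) 0 f'' f) (Ident G n x)"
    "bi_invertible G (Suc (Suc n)) R" "bi_invertible G (Suc (Suc n)) L"
  using assms(1)
proof (rule bi_invertibleE)
  fix m x' y' f' f'' R L
  assume *: "Suc n = Suc m" "arr G m f x' y'" "arr G m f' y' x'" "arr G m f'' y' x'"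
    "arr G (Suc m) R (Comp G (Suc m) 0 f f') (Ident G m y')"
    "arr G (Suc m) L (Comp G (Suc m) 0 f'' f) (Ident G m x')"
    "bi_invertible G (Suc (Suc n)) R" "bi_invertible G (Suc (Suc n)) L"
  then have "m = n" "x' = x" "y' = y" using arr_unique[OF assms(2)] by auto
  with * that show thesis by simp
qed

lemma qi_structureD:
  assumes "qi_structure G (Suc n) S f" "arr G n f x y"
  shows "arr G n (qi_inv S) y x" "quasi_invertible G (Suc n) (qi_inv S)"
    "arr G (Suc n) (qi_R S) (Comp G (Suc n) 0 f (qi_inv S)) (Ident G n y)"
    "quasi_invertible G (Suc (Suc n)) (qi_R S)"
    "arr G (Suc n) (qi_L S) (Comp G (Suc n) 0 (qi_inv S) f) (Ident G n x)"
    "quasi_invertible G (Suc (Suc n)) (qi_L S)"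
proof -
  from assms(1) obtain f' R L s t x' y' where S: "S = QI f' R L s t"
    and f: "arr G n f x' y'" and f': "arr G n f' y' x'"
    and R: "arr G (Suc n) R (Comp G (Suc n) 0 f f') (Ident G n y')"
    and L: "arr G (Suc n) L (Comp G (Suc n) 0 f' f) (Ident G n x')"
    and s: "qi_structure G (Suc (Suc n)) s R" and t: "qi_structure G (Suc (Suc n)) t L"
    by cases auto
  have "qi_structure G (Suc n) (QI f L R t s) f'"
    by (rule qi_structure.intros[OF f' f L R t s])
  moreover have "x' = x" "y' = y" using arr_unique[OF assms(2) f] by auto
  ultimately show "arr G n (qi_inv S) y x" "quasi_invertible G (Suc n) (qi_inv S)"
    "arr G (Suc n) (qi_R S) (Comp G (Suc n) 0 f (qi_inv S)) (Ident G n y)"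
    "quasi_invertible G (Suc (Suc n)) (qi_R S)"
    "arr G (Suc n) (qi_L S) (Comp G (Suc n) 0 (qi_inv S) f) (Ident G n x)"
    "quasi_invertible G (Suc (Suc n)) (qi_L S)"
    using S f' R L s t unfolding quasi_invertible_def by auto
qed

lemma half_adjoint_invertible_imp_quasi_invertible:
  assumes "half_adjoint_invertible G n f"
  shows "quasi_invertible G n f"
proof -
  define X where "X n f \<longleftrightarrow> half_adjoint_invertible G n f \<or>
    (\<exists>S g. hai_structure G n S g \<and> f = hai_inv S)" for n f
  show ?thesis
  proof (rule quasi_invertible_coinduct[where X = X])
    show "X n f" using assms by (simp add: X_def)
  next
    fix n f assume "X n f"
    then obtain S g where S: "hai_structure G n S g" "f = g \<or> f = hai_inv S"
      by (auto simp: X_def half_adjoint_invertible_def)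
    from S(1) obtain m x y g' \<alpha> \<beta> \<gamma> s t u where *: "n = Suc m" "S = HAI g' \<alpha> \<beta> \<gamma> s t u"
      "arr G m g x y" "arr G m g' y x"
      "arr G (Suc m) \<alpha> (Comp G (Suc m) 0 g g') (Ident G m y)"
      "arr G (Suc m) \<beta> (Ident G m x) (Comp G (Suc m) 0 g' g)"
      "hai_structure G (Suc (Suc m)) s \<alpha>" "hai_structure G (Suc (Suc m)) t \<beta>"
      by cases auto
    from *(8) have \<beta>': "arr G (Suc m) (hai_inv t) (Comp G (Suc m) 0 g' g) (Ident G m x)"
    proof cases
      case (1 x' y')
      with arr_unique[OF *(6) 1(2)] show ?thesis by auto
    qed
    have X: "X (Suc n) \<alpha>" "X (Suc n) (hai_inv t)"
      using * unfolding X_def half_adjoint_invertible_def by blast+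
    show "\<exists>m x y f' R L. n = Suc m \<and> arr G m f x y \<and> arr G m f' y x \<and>
      arr G (Suc m) R (Comp G (Suc m) 0 f f') (Ident G m y) \<and>
      arr G (Suc m) L (Comp G (Suc m) 0 f' f) (Ident G m x) \<and> X (Suc n) R \<and> X (Suc n) L"
      using S(2)
    proof
      assume "f = g" with * \<beta>' X show ?thesis by blast
    next
      assume "f = hai_inv S" then have "f = g'" using *(2) by simp
      with * \<beta>' X show ?thesis by blast
    qed
  qed
qed

section \<open>Closure of the invertible cells under composition\<close>

inductive bi_closure :: "('c, 'z) gset_ic_scheme \<Rightarrow> nat \<Rightarrow> 'c \<Rightarrow> bool"
  for G :: "('c, 'z) gset_ic_scheme" where
  bi_closure_base: "bi_invertible G n f \<Longrightarrow> bi_closure G n f"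
| bi_closure_right_inverse:
    "bi_invertible G (Suc n) g \<Longrightarrow> arr G n g x y \<Longrightarrow> arr G n f y x \<Longrightarrow>
     arr G (Suc n) R (Comp G (Suc n) 0 g f) (Ident G n y) \<Longrightarrow>
     bi_invertible G (Suc (Suc n)) R \<Longrightarrow> bi_closure G (Suc n) f"
| bi_closure_Comp:
    "composable G n k f g \<Longrightarrow> bi_closure G n f \<Longrightarrow> bi_closure G n g \<Longrightarrow>
     bi_closure G n (Comp G n k f g)"

lemma bi_closure_quasi_invertible: "quasi_invertible G n f \<Longrightarrow> bi_closure G n f"
  by (simp add: bi_closure_base quasi_invertible_imp_bi_invertible)

locale precategory =
  fixes G :: "'c precat"
  assumes globular_set_ic: "globular_set_ic G"
    and has_unitors: "has_unitors G"
    and has_associators: "has_associators G"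
    and has_interchangers: "has_interchangers G"
    and has_id_comps: "has_id_comps G"
begin

abbreviation vcomp :: "'c \<Rightarrow> nat \<Rightarrow> 'c \<Rightarrow> 'c" ("_ \<cdot>\<^bsub>_\<^esub> _" [71, 0, 70] 70) where
  "g \<cdot>\<^bsub>n\<^esub> f \<equiv> Comp G n 0 g f"

abbreviation hcomp :: "'c \<Rightarrow> nat \<Rightarrow> 'c \<Rightarrow> 'c" ("_ \<diamondop>\<^bsub>_\<^esub> _" [76, 0, 75] 75) where
  "g \<diamondop>\<^bsub>n\<^esub> f \<equiv> Comp G n (Suc 0) g f"

definition inv_arr :: "nat \<Rightarrow> 'c \<Rightarrow> 'c \<Rightarrow> 'c \<Rightarrow> bool" where
  "inv_arr n s a b \<longleftrightarrow> arr G n s a b \<and> bi_closure G (Suc n) s"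

lemma inv_arr_arr: "inv_arr n s a b \<Longrightarrow> arr G n s a b"
  by (simp add: inv_arr_def)

lemma inv_arrI: "arr G n s a b \<Longrightarrow> quasi_invertible G (Suc n) s \<Longrightarrow> inv_arr n s a b"
  by (simp add: inv_arr_def bi_closure_quasi_invertible)

lemma inv_arrI_structure: "arr G n s a b \<Longrightarrow> qi_structure G (Suc n) S s \<Longrightarrow> inv_arr n s a b"
  by (rule inv_arrI) (auto simp: quasi_invertible_def)

definition equivalent :: "nat \<Rightarrow> 'c \<Rightarrow> 'c \<Rightarrow> bool" where
  "equivalent n s t \<longleftrightarrow> (\<exists>h. inv_arr n h s t)"

lemma equivalentI: "inv_arr n h s t \<Longrightarrow> equivalent n s t"
  by (auto simp: equivalent_def)

lemma arr_cells: "arr G n f x y \<Longrightarrow> x \<in> Cells G n \<and> y \<in> Cells G n \<and> f \<in> Cells G (Suc n)"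
  using globular_set_ic by (auto simp: globular_set_ic_def globular_set_def arr_def)

lemma arr_Ident: "x \<in> Cells G n \<Longrightarrow> arr G n (Ident G n x) x x"
  using globular_set_ic unfolding globular_set_ic_def by blast

lemma arr_vcomp: "arr G n g y z \<Longrightarrow> arr G n f x y \<Longrightarrow> arr G n (g \<cdot>\<^bsub>Suc n\<^esub> f) x z"
  using globular_set_ic unfolding globular_set_ic_def by blast

lemma arr_Comp_Suc:
  "arr G n \<alpha> f g \<Longrightarrow> arr G n \<beta> h j \<Longrightarrow> composable G n k f h \<Longrightarrow> composable G n k g j \<Longrightarrow>
   arr G n (Comp G (Suc n) (Suc k) \<alpha> \<beta>) (Comp G n k f h) (Comp G n k g j)"
  using globular_set_ic unfolding globular_set_ic_def by blast

lemma inv_arr_vcomp: "inv_arr n g y z \<Longrightarrow> inv_arr n f x y \<Longrightarrow> inv_arr n (g \<cdot>\<^bsub>Suc n\<^esub> f) x z"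
  unfolding inv_arr_def by (meson arr_vcomp bi_closure_Comp composable_0)

lemma inv_arr_Comp_Suc:
  "inv_arr n \<alpha> f g \<Longrightarrow> inv_arr n \<beta> h j \<Longrightarrow> composable G n k f h \<Longrightarrow> composable G n k g j \<Longrightarrow>
   inv_arr n (Comp G (Suc n) (Suc k) \<alpha> \<beta>) (Comp G n k f h) (Comp G n k g j)"
  unfolding inv_arr_def by (meson arr_Comp_Suc bi_closure_Comp composable_Suc)

lemma inv_arr_hcomp:
  assumes "inv_arr (Suc n) \<alpha> f g" "inv_arr (Suc n) \<beta> h j"
    and "arr G n f y z" "arr G n g y z" "arr G n h x y" "arr G n j x y"
  shows "inv_arr (Suc n) (\<alpha> \<diamondop>\<^bsub>Suc (Suc n)\<^esub> \<beta>) (f \<cdot>\<^bsub>Suc n\<^esub> h) (g \<cdot>\<^bsub>Suc n\<^esub> j)"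
  using assms by (meson inv_arr_Comp_Suc composable_0)

context
  fixes n f x y assumes f: "arr G n f x y"
begin

lemma unitor_facts:
  "arr G (Suc n) (LUnit G (Suc n) f) (Ident G n y \<cdot>\<^bsub>Suc n\<^esub> f) f"
  "qi_structure G (Suc (Suc n)) (LUnit_QI G (Suc n) f) (LUnit G (Suc n) f)"
  "arr G (Suc n) (RUnit G (Suc n) f) (f \<cdot>\<^bsub>Suc n\<^esub> Ident G n x) f"
  "qi_structure G (Suc (Suc n)) (RUnit_QI G (Suc n) f) (RUnit G (Suc n) f)"
  using has_unitors f unfolding has_unitors_def by blast+

lemma inv_arr_LUnit: "inv_arr (Suc n) (LUnit G (Suc n) f) (Ident G n y \<cdot>\<^bsub>Suc n\<^esub> f) f"
  using unitor_facts inv_arrI_structure by blast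

lemma inv_arr_LUnit_inv:
  "inv_arr (Suc n) (qi_inv (LUnit_QI G (Suc n) f)) f (Ident G n y \<cdot>\<^bsub>Suc n\<^esub> f)"
  using qi_structureD[OF unitor_facts(2,1)] inv_arrI by blast

lemma inv_arr_RUnit_inv:
  "inv_arr (Suc n) (qi_inv (RUnit_QI G (Suc n) f)) f (f \<cdot>\<^bsub>Suc n\<^esub> Ident G n x)"
  using qi_structureD[OF unitor_facts(4,3)] inv_arrI by blast

end

lemma LUnit_LUnit_inv:
  assumes "arr G n f x y"
  shows "equivalent (Suc (Suc n))
    (LUnit G (Suc n) f \<cdot>\<^bsub>Suc (Suc n)\<^esub> qi_inv (LUnit_QI G (Suc n) f)) (Ident G (Suc n) f)"
  using qi_structureD(3,4)[OF unitor_facts(2,1)[OF assms]] inv_arrI equivalentI by blast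

lemma inv_arr_Ident: assumes "x \<in> Cells G n" shows "inv_arr n (Ident G n x) x x"
proof -
  note i = arr_Ident[OF assms]
  note u = unitor_facts(1,2)[OF i]
  have "qi_structure G (Suc n) (QI (Ident G n x) (LUnit G (Suc n) (Ident G n x))
      (LUnit G (Suc n) (Ident G n x)) (LUnit_QI G (Suc n) (Ident G n x))
      (LUnit_QI G (Suc n) (Ident G n x))) (Ident G n x)"
    by (rule qi_structure.intros[OF i i u(1) u(1) u(2) u(2)])
  with i show ?thesis using inv_arrI_structure by blast
qed

context
  fixes n f g h w x y z
  assumes f: "arr G n f y z" and g: "arr G n g x y" and h: "arr G n h w x"
begin

lemma associator_facts:
  "arr G (Suc n) (Assoc G (Suc n) f g h)
     ((f \<cdot>\<^bsub>Suc n\<^esub> g) \<cdot>\<^bsub>Suc n\<^esub> h) (f \<cdot>\<^bsub>Suc n\<^esub> (g \<cdot>\<^bsub>Suc n\<^esub> h))"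
  "qi_structure G (Suc (Suc n)) (Assoc_QI G (Suc n) f g h) (Assoc G (Suc n) f g h)"
  using has_associators composable_0[OF g f] composable_0[OF h g]
  unfolding has_associators_def by blast+

lemma inv_arr_Assoc:
  "inv_arr (Suc n) (Assoc G (Suc n) f g h)
     ((f \<cdot>\<^bsub>Suc n\<^esub> g) \<cdot>\<^bsub>Suc n\<^esub> h) (f \<cdot>\<^bsub>Suc n\<^esub> (g \<cdot>\<^bsub>Suc n\<^esub> h))"
  using associator_facts inv_arrI_structure by blast

lemma inv_arr_Assoc_inv:
  "inv_arr (Suc n) (qi_inv (Assoc_QI G (Suc n) f g h))
     (f \<cdot>\<^bsub>Suc n\<^esub> (g \<cdot>\<^bsub>Suc n\<^esub> h)) ((f \<cdot>\<^bsub>Suc n\<^esub> g) \<cdot>\<^bsub>Suc n\<^esub> h)"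
  using qi_structureD[OF associator_facts(2,1)] inv_arrI by blast

end

lemma Assoc_inv_Assoc:
  assumes "arr G n f y z" "arr G n g x y" "arr G n h w x"
  shows "equivalent (Suc (Suc n))
    (qi_inv (Assoc_QI G (Suc n) f g h) \<cdot>\<^bsub>Suc (Suc n)\<^esub> Assoc G (Suc n) f g h)
    (Ident G (Suc n) ((f \<cdot>\<^bsub>Suc n\<^esub> g) \<cdot>\<^bsub>Suc n\<^esub> h))"
  using qi_structureD(5,6)[OF associator_facts(2,1)[OF assms]] inv_arrI equivalentI by blast

lemma equivalent_refl: "s \<in> Cells G n \<Longrightarrow> equivalent n s s"
  using inv_arr_Ident equivalentI by blast

lemma equivalent_trans [trans]: "equivalent n r s \<Longrightarrow> equivalent n s t \<Longrightarrow> equivalent n r t"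
  unfolding equivalent_def using inv_arr_vcomp by blast

lemma equivalent_Comp:
  "equivalent n f g \<Longrightarrow> equivalent n h j \<Longrightarrow> composable G n k f h \<Longrightarrow> composable G n k g j \<Longrightarrow>
   equivalent n (Comp G n k f h) (Comp G n k g j)"
  unfolding equivalent_def using inv_arr_Comp_Suc by blast

lemma equivalent_vcomp:
  "equivalent (Suc n) f g \<Longrightarrow> equivalent (Suc n) h j \<Longrightarrow>
   arr G n f y z \<Longrightarrow> arr G n g y z \<Longrightarrow> arr G n h x y \<Longrightarrow> arr G n j x y \<Longrightarrow>
   equivalent (Suc n) (f \<cdot>\<^bsub>Suc n\<^esub> h) (g \<cdot>\<^bsub>Suc n\<^esub> j)"
  unfolding equivalent_def using inv_arr_hcomp by blast

lemma equivalent_vcomp_right: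
  "equivalent (Suc n) h j \<Longrightarrow> arr G n f y z \<Longrightarrow> arr G n h x y \<Longrightarrow> arr G n j x y \<Longrightarrow>
   equivalent (Suc n) (f \<cdot>\<^bsub>Suc n\<^esub> h) (f \<cdot>\<^bsub>Suc n\<^esub> j)"
  by (meson equivalent_vcomp equivalent_refl arr_cells)

lemma equivalent_vcomp_left:
  "equivalent (Suc n) f g \<Longrightarrow> arr G n f y z \<Longrightarrow> arr G n g y z \<Longrightarrow> arr G n h x y \<Longrightarrow>
   equivalent (Suc n) (f \<cdot>\<^bsub>Suc n\<^esub> h) (g \<cdot>\<^bsub>Suc n\<^esub> h)"
  by (meson equivalent_vcomp equivalent_refl arr_cells)

lemma cancel_identity:
  assumes "equivalent (Suc n) f (Ident G n y)" "arr G n f y y" "arr G n h x y"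
  shows "equivalent (Suc n) (f \<cdot>\<^bsub>Suc n\<^esub> h) h"
proof -
  have "equivalent (Suc n) (f \<cdot>\<^bsub>Suc n\<^esub> h) (Ident G n y \<cdot>\<^bsub>Suc n\<^esub> h)"
    using assms by (meson equivalent_vcomp_left arr_Ident arr_cells)
  also have "equivalent (Suc n) (Ident G n y \<cdot>\<^bsub>Suc n\<^esub> h) h"
    using assms(3) inv_arr_LUnit equivalentI by blast
  finally show ?thesis .
qed

lemma cancel_inverse:
  assumes "equivalent (Suc n) (g \<cdot>\<^bsub>Suc n\<^esub> f) (Ident G n y)"
    and "arr G n g z y" "arr G n f y z" "arr G n h x y"
  shows "equivalent (Suc n) (g \<cdot>\<^bsub>Suc n\<^esub> (f \<cdot>\<^bsub>Suc n\<^esub> h)) h"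
proof -
  have "equivalent (Suc n) (g \<cdot>\<^bsub>Suc n\<^esub> (f \<cdot>\<^bsub>Suc n\<^esub> h)) ((g \<cdot>\<^bsub>Suc n\<^esub> f) \<cdot>\<^bsub>Suc n\<^esub> h)"
    using assms inv_arr_Assoc_inv equivalentI by blast
  also have "equivalent (Suc n) ((g \<cdot>\<^bsub>Suc n\<^esub> f) \<cdot>\<^bsub>Suc n\<^esub> h) h"
    using assms by (meson cancel_identity arr_vcomp)
  finally show ?thesis .
qed

text \<open>The pattern \<open>(g \<cdot> f) \<cdot> (f' \<cdot> g')\<close> serves for both the right and the left inverse of \<open>g \<cdot> f\<close>.\<close>

lemma cancel_middle:
  assumes f: "arr G n f x y" and f': "arr G n f' y x"
    and g: "arr G n g y z" and g': "arr G n g' z y"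
    and R: "equivalent (Suc n) (f \<cdot>\<^bsub>Suc n\<^esub> f') (Ident G n y)"
    and S: "equivalent (Suc n) (g \<cdot>\<^bsub>Suc n\<^esub> g') (Ident G n z)"
  shows "equivalent (Suc n) ((g \<cdot>\<^bsub>Suc n\<^esub> f) \<cdot>\<^bsub>Suc n\<^esub> (f' \<cdot>\<^bsub>Suc n\<^esub> g')) (Ident G n z)"
proof -
  have "equivalent (Suc n) ((g \<cdot>\<^bsub>Suc n\<^esub> f) \<cdot>\<^bsub>Suc n\<^esub> (f' \<cdot>\<^bsub>Suc n\<^esub> g'))
      (g \<cdot>\<^bsub>Suc n\<^esub> (f \<cdot>\<^bsub>Suc n\<^esub> (f' \<cdot>\<^bsub>Suc n\<^esub> g')))"
    using inv_arr_Assoc[OF g f arr_vcomp[OF f' g']] equivalentI by blast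
  also have "equivalent (Suc n) (g \<cdot>\<^bsub>Suc n\<^esub> (f \<cdot>\<^bsub>Suc n\<^esub> (f' \<cdot>\<^bsub>Suc n\<^esub> g'))) (g \<cdot>\<^bsub>Suc n\<^esub> g')"
    using cancel_inverse[OF R f f' g'] f f' g g' by (meson equivalent_vcomp_right arr_vcomp)
  also note S
  finally show ?thesis .
qed

lemma interchange:
  assumes "arr G n \<alpha> f g" "arr G n \<alpha>' g' f" "arr G n \<beta> h j" "arr G n \<beta>' j' h"
    and "composable G n k f h" "composable G n k g j" "composable G n k g' j'"
  shows "equivalent (Suc n)
    (Comp G (Suc n) (Suc k) \<alpha> \<beta> \<cdot>\<^bsub>Suc n\<^esub> Comp G (Suc n) (Suc k) \<alpha>' \<beta>')
    (Comp G (Suc n) (Suc k) (\<alpha> \<cdot>\<^bsub>Suc n\<^esub> \<alpha>') (\<beta> \<cdot>\<^bsub>Suc n\<^esub> \<beta>'))"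
proof -
  have "composable G (Suc n) (Suc k) \<alpha> \<beta>" "composable G (Suc n) (Suc k) \<alpha>' \<beta>'"
    "composable G (Suc n) 0 \<alpha> \<alpha>'" "composable G (Suc n) 0 \<beta> \<beta>'"
    using assms by (meson composable.intros)+
  then show ?thesis
    using has_interchangers unfolding has_interchangers_def
    by (meson equivalentI inv_arrI_structure zero_less_Suc)
qed

lemma equivalent_Comp_Ident:
  assumes "composable G n k f g"
  shows "equivalent (Suc n) (Comp G (Suc n) (Suc k) (Ident G n f) (Ident G n g))
    (Ident G n (Comp G n k f g))"
  using has_id_comps assms unfolding has_id_comps_def
  by (meson equivalentI inv_arrI_structure)

lemma Comp_inverse:
  assumes \<alpha>: "arr G n \<alpha> f g" "arr G n \<alpha>' g f" and \<beta>: "arr G n \<beta> h j" "arr G n \<beta>' j h"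
    and k: "composable G n k f h" "composable G n k g j"
    and R: "equivalent (Suc n) (\<alpha> \<cdot>\<^bsub>Suc n\<^esub> \<alpha>') (Ident G n g)"
    and S: "equivalent (Suc n) (\<beta> \<cdot>\<^bsub>Suc n\<^esub> \<beta>') (Ident G n j)"
  shows "equivalent (Suc n)
    (Comp G (Suc n) (Suc k) \<alpha> \<beta> \<cdot>\<^bsub>Suc n\<^esub> Comp G (Suc n) (Suc k) \<alpha>' \<beta>')
    (Ident G n (Comp G n k g j))"
proof -
  note interchange[OF \<alpha> \<beta> k k(2)]
  also have "equivalent (Suc n) (Comp G (Suc n) (Suc k) (\<alpha> \<cdot>\<^bsub>Suc n\<^esub> \<alpha>') (\<beta> \<cdot>\<^bsub>Suc n\<^esub> \<beta>'))
      (Comp G (Suc n) (Suc k) (Ident G n g) (Ident G n j))"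
  proof (rule equivalent_Comp[OF R S])
    show "composable G (Suc n) (Suc k) (\<alpha> \<cdot>\<^bsub>Suc n\<^esub> \<alpha>') (\<beta> \<cdot>\<^bsub>Suc n\<^esub> \<beta>')"
      using composable_Suc[OF arr_vcomp[OF \<alpha>] arr_vcomp[OF \<beta>] k(2) k(2)] .
    show "composable G (Suc n) (Suc k) (Ident G n g) (Ident G n j)"
      using \<alpha>(1) \<beta>(1) k by (meson composable_Suc arr_Ident arr_cells)
  qed
  also note equivalent_Comp_Ident[OF k(2)]
  finally show ?thesis .
qed

lemma right_inverse_is_left_inverse:
  assumes f: "arr G n f x y" and r: "arr G n r y x" and l: "arr G n l y x"
    and R: "equivalent (Suc n) (f \<cdot>\<^bsub>Suc n\<^esub> r) (Ident G n y)"
    and L: "equivalent (Suc n) (l \<cdot>\<^bsub>Suc n\<^esub> f) (Ident G n x)"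
    and L': "equivalent (Suc n) (Ident G n x) (l \<cdot>\<^bsub>Suc n\<^esub> f)"
  shows "equivalent (Suc n) (r \<cdot>\<^bsub>Suc n\<^esub> f) (Ident G n x)"
proof -
  note arrs = f r l arr_vcomp[OF r f] arr_vcomp[OF l f]
  have x: "arr G n (Ident G n x) x x" using f arr_Ident arr_cells by blast
  have "equivalent (Suc n) (r \<cdot>\<^bsub>Suc n\<^esub> f) (Ident G n x \<cdot>\<^bsub>Suc n\<^esub> (r \<cdot>\<^bsub>Suc n\<^esub> f))"
    using inv_arr_LUnit_inv[OF arrs(4)] equivalentI by blast
  also have "equivalent (Suc n) \<dots> ((l \<cdot>\<^bsub>Suc n\<^esub> f) \<cdot>\<^bsub>Suc n\<^esub> (r \<cdot>\<^bsub>Suc n\<^esub> f))"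
    by (rule equivalent_vcomp_left[OF L' x arrs(5,4)])
  also have "equivalent (Suc n) \<dots> (Ident G n x)"
    by (rule cancel_middle[OF f r l f R L])
  finally show ?thesis .
qed

lemma bi_invertible_right_inverse:
  assumes f: "bi_invertible G (Suc n) f" and arr: "arr G n f x y" "arr G n r y x"
    and R: "equivalent (Suc n) (f \<cdot>\<^bsub>Suc n\<^esub> r) (Ident G n y)"
  shows "equivalent (Suc n) (r \<cdot>\<^bsub>Suc n\<^esub> f) (Ident G n x)"
proof -
  obtain l L where l: "arr G n l y x"
    and L: "arr G (Suc n) L (l \<cdot>\<^bsub>Suc n\<^esub> f) (Ident G n x)" "bi_invertible G (Suc (Suc n)) L"
    by (rule bi_invertible_arrE[OF f arr(1)])
  obtain K M where *: "arr G (Suc n) K (Ident G n x) (l \<cdot>\<^bsub>Suc n\<^esub> f)"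
    "arr G (Suc (Suc n)) M (L \<cdot>\<^bsub>Suc (Suc n)\<^esub> K) (Ident G (Suc n) (Ident G n x))"
    "bi_invertible G (Suc (Suc (Suc n))) M"
    by (rule bi_invertible_arrE[OF L(2,1)])
  have "inv_arr (Suc n) K (Ident G n x) (l \<cdot>\<^bsub>Suc n\<^esub> f)"
    unfolding inv_arr_def using bi_closure_right_inverse[OF L(2,1) *] *(1) by simp
  moreover have "inv_arr (Suc n) L (l \<cdot>\<^bsub>Suc n\<^esub> f) (Ident G n x)"
    using L by (simp add: inv_arr_def bi_closure_base)
  ultimately show ?thesis
    by (meson right_inverse_is_left_inverse[OF arr l R] equivalentI)
qed

lemma bi_closure_step:
  assumes "bi_closure G n f"
  shows "\<exists>m x y f'. n = Suc m \<and> arr G m f x y \<and> arr G m f' y x \<and>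
    equivalent n (f \<cdot>\<^bsub>n\<^esub> f') (Ident G m y) \<and> equivalent n (f' \<cdot>\<^bsub>n\<^esub> f) (Ident G m x)"
  using assms
proof induction
  case (bi_closure_base n f)
  obtain m x y f' f'' R L where *: "n = Suc m" "arr G m f x y" "arr G m f' y x" "arr G m f'' y x"
    "arr G (Suc m) R (f \<cdot>\<^bsub>Suc m\<^esub> f') (Ident G m y)"
    "arr G (Suc m) L (f'' \<cdot>\<^bsub>Suc m\<^esub> f) (Ident G m x)"
    "bi_invertible G (Suc n) R" "bi_invertible G (Suc n) L"
    by (rule bi_invertibleE[OF bi_closure_base])
  then have "equivalent n (f \<cdot>\<^bsub>n\<^esub> f') (Ident G m y)"
    by (auto intro!: equivalentI simp: inv_arr_def bi_closure.bi_closure_base)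
  moreover from this have "equivalent n (f' \<cdot>\<^bsub>n\<^esub> f) (Ident G m x)"
    using bi_invertible_right_inverse[of m f x y f'] * bi_closure_base by simp
  ultimately show ?case using * by blast
next
  case (bi_closure_right_inverse n g x y f R)
  then have "equivalent (Suc n) (g \<cdot>\<^bsub>Suc n\<^esub> f) (Ident G n y)"
    by (auto intro!: equivalentI simp: inv_arr_def bi_closure.bi_closure_base)
  moreover from this have "equivalent (Suc n) (f \<cdot>\<^bsub>Suc n\<^esub> g) (Ident G n x)"
    using bi_invertible_right_inverse[of n g x y f] bi_closure_right_inverse by simp
  ultimately show ?case using bi_closure_right_inverse by blast
next
  case (bi_closure_Comp n k g f)
  from bi_closure_Comp.IH obtain m a b g' c d f' where n: "n = Suc m"
    and g: "arr G m g a b" "arr G m g' b a"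
      "equivalent (Suc m) (g \<cdot>\<^bsub>Suc m\<^esub> g') (Ident G m b)"
      "equivalent (Suc m) (g' \<cdot>\<^bsub>Suc m\<^esub> g) (Ident G m a)"
    and f: "arr G m f c d" "arr G m f' d c"
      "equivalent (Suc m) (f \<cdot>\<^bsub>Suc m\<^esub> f') (Ident G m d)"
      "equivalent (Suc m) (f' \<cdot>\<^bsub>Suc m\<^esub> f) (Ident G m c)"
    by blast
  from bi_closure_Comp.hyps(1) show ?case
  proof cases
    case (composable_0 i x y z)
    with n g f have "d = a" by (auto dest: arr_unique)
    note f = f[unfolded \<open>d = a\<close>]
    show ?thesis
      using n composable_0(2) arr_vcomp[OF g(1) f(1)] arr_vcomp[OF f(2) g(2)]
        cancel_middle[OF f(1,2) g(1,2) f(3) g(3)] cancel_middle[OF g(2,1) f(2,1) g(4) f(4)]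
      by auto
  next
    case (composable_Suc i r s t u j)
    then have "i = m" "r = a" "s = b" "t = c" "u = d" using n g f by (auto dest: arr_unique)
    with composable_Suc have k: "composable G m j a c" "composable G m j b d" "k = Suc j" by auto
    show ?thesis
      using n k(3) arr_Comp_Suc[OF g(1) f(1) k(1,2)] arr_Comp_Suc[OF g(2) f(2) k(2,1)]
        Comp_inverse[OF g(1,2) f(1,2) k(1,2) g(3) f(3)]
        Comp_inverse[OF g(2,1) f(2,1) k(2,1) g(4) f(4)]
      by auto
  qed
qed

lemma bi_closure_imp_quasi_invertible: "bi_closure G n f \<Longrightarrow> quasi_invertible G n f"
proof (erule quasi_invertible_coinduct[where X = "bi_closure G"])
  fix n f assume "bi_closure G n f"
  from bi_closure_step[OF this]
  show "\<exists>m x y f' R L. n = Suc m \<and> arr G m f x y \<and> arr G m f' y x \<and>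
      arr G (Suc m) R (f \<cdot>\<^bsub>Suc m\<^esub> f') (Ident G m y) \<and>
      arr G (Suc m) L (f' \<cdot>\<^bsub>Suc m\<^esub> f) (Ident G m x) \<and>
      bi_closure G (Suc n) R \<and> bi_closure G (Suc n) L"
    unfolding equivalent_def inv_arr_def by blast
qed

lemma inv_arr_inverse:
  assumes "inv_arr n f x y"
  obtains f' where "inv_arr n f' y x" "equivalent (Suc n) (f \<cdot>\<^bsub>Suc n\<^esub> f') (Ident G n y)"
    "equivalent (Suc n) (f' \<cdot>\<^bsub>Suc n\<^esub> f) (Ident G n x)"
proof -
  from assms obtain S where S: "qi_structure G (Suc n) S f" and f: "arr G n f x y"
    using bi_closure_imp_quasi_invertible unfolding inv_arr_def quasi_invertible_def by blast
  note D = qi_structureD[OF S f]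
  from inv_arrI[OF D(1,2)] equivalentI[OF inv_arrI[OF D(3,4)]] equivalentI[OF inv_arrI[OF D(5,6)]]
  show thesis by (rule that)
qed

end

section \<open>String diagrams and half-adjointness\<close>

text \<open>\<open>H\<close> is \<open>G\<close> itself or a hom globular set of \<open>G\<close>, placed so that its \<open>m\<close>-cells are \<open>(n + m)\<close>-cells of
  \<open>G\<close>. Diagrams are drawn in \<open>H\<close>, while cells are typed and shown to be invertible in \<open>G\<close>.\<close>

locale hom_calculus = precategory G for G :: "'c precat" +
  fixes H :: "'c precat" and n :: nat
  assumes object: "Cells H 0 \<subseteq> Cells G n"
    and lift: "arr G (n + m) f a b \<Longrightarrow> a \<in> Cells H m \<Longrightarrow> b \<in> Cells H m \<Longrightarrow> arr H m f a b"
    and Ident: "Ident H m = Ident G (n + m)"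
    and Comp: "Comp H m = Comp G (n + m)"
    and LUnit: "LUnit H m = LUnit G (n + m)" "LUnit_QI H m = LUnit_QI G (n + m)"
    and RUnit: "RUnit H m = RUnit G (n + m)" "RUnit_QI H m = RUnit_QI G (n + m)"
    and Assoc: "Assoc H m = Assoc G (n + m)" "Assoc_QI H m = Assoc_QI G (n + m)"
    and calculus: "isotopic D E \<Longrightarrow> represents H D p q s \<Longrightarrow> represents H E p q t \<Longrightarrow>
      equivalent (Suc (Suc n)) s t"
begin

lemmas operations = Ident Comp LUnit RUnit Assoc

lemma composite_Beside:
  "composite H (Beside b c) = composite H b \<cdot>\<^bsub>Suc n\<^esub> composite H c"
  by (simp add: operations)

lemma composite_Blank: "composite H (Blank x) = Ident G n x"
  by (simp add: operations)

definition word :: "'c bracketing \<Rightarrow> 'c \<Rightarrow> 'c \<Rightarrow> bool" where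
  "word b u v \<longleftrightarrow> well_typed H b \<and> arr G n (composite H b) u v \<and> u \<in> Cells H 0 \<and> v \<in> Cells H 0"

lemma word_arr: "word b u v \<Longrightarrow> arr G n (composite H b) u v"
  by (simp add: word_def)

lemma word_lift: "word b u v \<Longrightarrow> arr H 0 (composite H b) u v"
  using lift[of 0] by (simp add: word_def)

lemma word_Blank: "x \<in> Cells H 0 \<Longrightarrow> word (Blank x) x x"
  using object arr_Ident by (auto simp: word_def operations)

lemma word_Wire:
  "arr G n f x y \<Longrightarrow> x \<in> Cells H 0 \<Longrightarrow> y \<in> Cells H 0 \<Longrightarrow> word (Wire f) x y"
  using lift[of 0 f x y] by (auto simp: word_def arr_def)

lemma word_Beside: "word b v w \<Longrightarrow> word c u v \<Longrightarrow> word (Beside b c) u w"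
  using word_lift[of b v w] word_lift[of c u v]
    arr_vcomp[of n "composite H b" v w "composite H c" u]
    composable_0[of H 0 "composite H c" u v "composite H b" w]
  by (simp add: word_def composite_Beside del: composite.simps)

definition rep ::
    "'c diagram \<Rightarrow> 'c bracketing \<Rightarrow> 'c bracketing \<Rightarrow> 'c \<Rightarrow> 'c \<Rightarrow> 'c \<Rightarrow> bool" where
  "rep D b c u v s \<longleftrightarrow> represents H D b c s \<and> word b u v \<and> word c u v \<and>
     inv_arr (Suc n) s (composite H b) (composite H c)"

lemma rep_eqv: "rep D b c u v s \<Longrightarrow> inv_arr (Suc n) s (composite H b) (composite H c)"
  by (simp add: rep_def)

lemma rep_Ident: assumes "word b u v" shows "rep [] b b u v (Ident G (Suc n) (composite H b))"
  using assms rep_wires[of H b] inv_arr_Ident arr_cells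
  by (auto simp: rep_def word_def operations)

lemma rep_Node:
  assumes "word b u v" "word c u v" "inv_arr (Suc n) t (composite H b) (composite H c)"
  shows "rep [([], Node b t c, [])] b c u v t"
proof -
  have "arr H 1 t (composite H b) (composite H c)"
    using assms lift[of 1] word_lift inv_arr_arr by (simp add: arr_def)
  with assms show ?thesis using rep_node[of H b c t] by (simp add: rep_def word_def)
qed

lemma rep_vcomp:
  assumes "rep D b c u v s" "rep E c d u v t"
  shows "rep (D @ E) b d u v (t \<cdot>\<^bsub>Suc (Suc n)\<^esub> s)"
  using assms rep_above[of H D b c s E d t] inv_arr_vcomp
  by (auto simp: rep_def operations)

lemma rep_hcomp:
  assumes "rep D b c v w s" "rep E b' c' u v t"
  shows "rep (juxtapose [] D (wires b') @ juxtapose (wires c) E [])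
    (Beside b b') (Beside c c') u w (s \<diamondop>\<^bsub>Suc (Suc n)\<^esub> t)"
proof -
  have "word (Beside b b') u w" "word (Beside c c') u w"
    using assms word_Beside by (auto simp: rep_def)
  moreover have "inv_arr (Suc n) (s \<diamondop>\<^bsub>Suc (Suc n)\<^esub> t)
      (composite H (Beside b b')) (composite H (Beside c c'))"
    unfolding composite_Beside
    using assms by (auto simp: rep_def word_def intro: inv_arr_hcomp)
  ultimately show ?thesis
    using assms rep_beside[of H D b c s E b' c' t]
    by (simp add: rep_def operations numeral_2_eq_2 word_def)
qed

lemma rep_LUnit:
  assumes "word b u v"
  shows "rep [] (Beside (Blank v) b) b u v (LUnit G (Suc n) (composite H b))"
    and "rep [] b (Beside (Blank v) b) u v (qi_inv (LUnit_QI G (Suc n) (composite H b)))"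
proof -
  have "word (Beside (Blank v) b) u v"
    using assms word_Beside word_Blank word_def by blast
  with assms show "rep [] (Beside (Blank v) b) b u v (LUnit G (Suc n) (composite H b))"
    "rep [] b (Beside (Blank v) b) u v (qi_inv (LUnit_QI G (Suc n) (composite H b)))"
    using rep_left_unitor[of H v b] rep_left_unitor_inv[of H v b]
      inv_arr_LUnit[OF word_arr[OF assms]] inv_arr_LUnit_inv[OF word_arr[OF assms]]
    by (auto simp: rep_def word_def operations)
qed

lemma rep_RUnit_inv:
  assumes "word b u v"
  shows "rep [] b (Beside b (Blank u)) u v (qi_inv (RUnit_QI G (Suc n) (composite H b)))"
proof -
  have "word (Beside b (Blank u)) u v"
    using assms word_Beside word_Blank word_def by blast
  with assms show ?thesis
    using rep_right_unitor_inv[of H b u] inv_arr_RUnit_inv[OF word_arr[OF assms]]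
    by (auto simp: rep_def word_def operations)
qed

lemma rep_Assoc:
  assumes "word b w z" "word c v w" "word d u v"
  shows "rep [] (Beside (Beside b c) d) (Beside b (Beside c d)) u z
      (Assoc G (Suc n) (composite H b) (composite H c) (composite H d))"
    and "rep [] (Beside b (Beside c d)) (Beside (Beside b c) d) u z
      (qi_inv (Assoc_QI G (Suc n) (composite H b) (composite H c) (composite H d)))"
proof -
  have "word (Beside (Beside b c) d) u z" "word (Beside b (Beside c d)) u z"
    using assms word_Beside by blast+
  then show "rep [] (Beside (Beside b c) d) (Beside b (Beside c d)) u z
      (Assoc G (Suc n) (composite H b) (composite H c) (composite H d))"
    "rep [] (Beside b (Beside c d)) (Beside (Beside b c) d) u z
      (qi_inv (Assoc_QI G (Suc n) (composite H b) (composite H c) (composite H d)))"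
    using rep_associator[of H b c d] rep_associator_inv[of H b c d]
      inv_arr_Assoc[OF assms[THEN word_arr]] inv_arr_Assoc_inv[OF assms[THEN word_arr]]
    by (auto simp: rep_def word_def operations)
qed

end

locale inverse_pair = hom_calculus G H n for G H :: "'c precat" and n :: nat +
  fixes f g x y \<epsilon> \<epsilon>' \<eta> \<theta>
  assumes objects: "x \<in> Cells H 0" "y \<in> Cells H 0"
    and f: "arr G n f x y" and g: "arr G n g y x"
    and \<epsilon>: "inv_arr (Suc n) \<epsilon> (f \<cdot>\<^bsub>Suc n\<^esub> g) (Ident G n y)"
    and \<epsilon>': "inv_arr (Suc n) \<epsilon>' (Ident G n y) (f \<cdot>\<^bsub>Suc n\<^esub> g)"
    and \<eta>: "inv_arr (Suc n) \<eta> (Ident G n x) (g \<cdot>\<^bsub>Suc n\<^esub> f)"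
    and \<theta>: "inv_arr (Suc n) \<theta> (g \<cdot>\<^bsub>Suc n\<^esub> f) (Ident G n x)"
    and \<epsilon>\<epsilon>': "equivalent (Suc (Suc n)) (\<epsilon> \<cdot>\<^bsub>Suc (Suc n)\<^esub> \<epsilon>') (Ident G (Suc n) (Ident G n y))"
    and \<eta>\<theta>: "equivalent (Suc (Suc n)) (\<eta> \<cdot>\<^bsub>Suc (Suc n)\<^esub> \<theta>)
      (Ident G (Suc n) (g \<cdot>\<^bsub>Suc n\<^esub> f))"
begin

abbreviation F where "F \<equiv> Wire f"
abbreviation F' where "F' \<equiv> Wire g"
abbreviation X where "X \<equiv> Blank x"
abbreviation Y where "Y \<equiv> Blank y"
abbreviation "node_\<epsilon> \<equiv> Node (Beside F F') \<epsilon> Y"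
abbreviation "node_\<epsilon>' \<equiv> Node Y \<epsilon>' (Beside F F')"
abbreviation "node_\<eta> \<equiv> Node X \<eta> (Beside F' F)"
abbreviation "node_\<theta> \<equiv> Node (Beside F' F) \<theta> X"

lemma words: "word F x y" "word F' y x" "word X x x" "word Y y y"
  "word (Beside F F') y y" "word (Beside F' F) x x"
  using f g objects word_Wire word_Blank word_Beside by blast+

lemmas composites = composite.simps(2) composite_Blank composite_Beside

lemma rep_nodes:
  "rep [([], node_\<epsilon>, [])] (Beside F F') Y y y \<epsilon>"
  "rep [([], node_\<epsilon>', [])] Y (Beside F F') y y \<epsilon>'"
  "rep [([], node_\<eta>, [])] X (Beside F' F) x x \<eta>"
  "rep [([], node_\<theta>, [])] (Beside F' F) X x x \<theta>"
  using words \<epsilon> \<epsilon>' \<eta> \<theta> by (auto intro!: rep_Node simp del: composite.simps simp: composites)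

lemma rep_zigzag:
  assumes "rep D (Beside F F') Y y y \<alpha>"
  shows "rep (([f], node_\<eta>, []) # juxtapose [] D [f]) F F x y (zigzag G (Suc n) f g \<alpha> \<eta>)"
proof -
  note a = rep_RUnit_inv[OF words(1)]
    and b = rep_hcomp[OF rep_Ident[OF words(1)] rep_nodes(3)]
    and c = rep_Assoc(2)[OF words(1,2,1)]
    and d = rep_hcomp[OF assms rep_Ident[OF words(1)]]
    and e = rep_LUnit(1)[OF words(1)]
  show ?thesis
    using rep_vcomp[OF rep_vcomp[OF rep_vcomp[OF rep_vcomp[OF a b] c] d] e]
    by (simp add: zigzag_def juxtapose_def)
qed

lemma rep_counit:
  "\<exists>\<alpha>. rep [([], node_\<epsilon>', [f, g]), ([f], node_\<theta>, [g]), ([], node_\<epsilon>, [])] (Beside F F') Y y y \<alpha>"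
proof -
  note i = rep_Ident[OF words(1)] and i' = rep_Ident[OF words(2)]
  note a = rep_LUnit(2)[OF words(5)]
    and b = rep_hcomp[OF rep_nodes(2) rep_Ident[OF words(5)]]
    and c = rep_Assoc(1)[OF words(1,2,5)]
    and d = rep_hcomp[OF i rep_Assoc(2)[OF words(2,1,2)]]
    and e = rep_hcomp[OF i rep_hcomp[OF rep_nodes(4) i']]
    and h = rep_hcomp[OF i rep_LUnit(1)[OF words(2)]]
  show ?thesis
    using rep_vcomp[OF rep_vcomp[OF rep_vcomp[OF rep_vcomp[OF rep_vcomp[OF rep_vcomp[OF a b] c]
      d] e] h] rep_nodes(1)]
    by (auto simp: juxtapose_def)
qed

definition straightened :: 'c where
  "straightened =
     LUnit G (Suc n) f \<cdot>\<^bsub>Suc (Suc n)\<^esub>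
     ((\<epsilon> \<diamondop>\<^bsub>Suc (Suc n)\<^esub> Ident G (Suc n) f) \<cdot>\<^bsub>Suc (Suc n)\<^esub>
     (qi_inv (Assoc_QI G (Suc n) f g f) \<cdot>\<^bsub>Suc (Suc n)\<^esub>
     ((Ident G (Suc n) f \<diamondop>\<^bsub>Suc (Suc n)\<^esub> \<eta>) \<cdot>\<^bsub>Suc (Suc n)\<^esub>
     ((Ident G (Suc n) f \<diamondop>\<^bsub>Suc (Suc n)\<^esub> \<theta>) \<cdot>\<^bsub>Suc (Suc n)\<^esub>
     (Assoc G (Suc n) f g f \<cdot>\<^bsub>Suc (Suc n)\<^esub>
     ((\<epsilon>' \<diamondop>\<^bsub>Suc (Suc n)\<^esub> Ident G (Suc n) f) \<cdot>\<^bsub>Suc (Suc n)\<^esub>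
      qi_inv (LUnit_QI G (Suc n) f)))))))"

lemma rep_straightened:
  "rep [([], node_\<epsilon>', [f]), ([f], node_\<theta>, []), ([f], node_\<eta>, []), ([], node_\<epsilon>, [f])] F F x y
     straightened"
proof -
  note i = rep_Ident[OF words(1)]
  note a = rep_LUnit(2)[OF words(1)]
    and b = rep_hcomp[OF rep_nodes(2) i]
    and c = rep_Assoc(1)[OF words(1,2,1)]
    and d = rep_hcomp[OF i rep_nodes(4)]
    and e = rep_hcomp[OF i rep_nodes(3)]
    and h = rep_Assoc(2)[OF words(1,2,1)]
    and j = rep_hcomp[OF rep_nodes(1) i]
    and k = rep_LUnit(1)[OF words(1)]
  show ?thesis
    using rep_vcomp[OF rep_vcomp[OF rep_vcomp[OF rep_vcomp[OF rep_vcomp[OF rep_vcomp[OF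
      rep_vcomp[OF a b] c] d] e] h] j] k]
    by (simp add: juxtapose_def straightened_def)
qed

lemma straightened_equivalent: "equivalent (Suc (Suc n)) straightened (Ident G (Suc n) f)"
proof -
  let ?i = "Ident G (Suc n) f"
  have cells: "f \<in> Cells G (Suc n)" "x \<in> Cells G n" "y \<in> Cells G n"
    using f arr_cells by blast+
  note i = arr_Ident[OF cells(1)]
  have ii: "equivalent (Suc (Suc n)) (?i \<cdot>\<^bsub>Suc (Suc n)\<^esub> ?i) ?i"
    using inv_arr_LUnit[OF i] equivalentI by blast
  note arrs = \<epsilon>[THEN inv_arr_arr] \<epsilon>'[THEN inv_arr_arr] \<eta>[THEN inv_arr_arr] \<theta>[THEN inv_arr_arr]
  note idx = arr_Ident[OF cells(2)] and idy = arr_Ident[OF cells(3)]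
  note fg = arr_vcomp[OF f g] and gf = arr_vcomp[OF g f]
  have k: "composable G (Suc n) 0 (f \<cdot>\<^bsub>Suc n\<^esub> g) f" "composable G (Suc n) 0 (Ident G n y) f"
    "composable G (Suc n) 0 f (g \<cdot>\<^bsub>Suc n\<^esub> f)" "composable G (Suc n) 0 f (Ident G n x)"
    by (rule composable_0[OF f fg] composable_0[OF f idy] composable_0[OF gf f]
      composable_0[OF idx f])+
  note \<epsilon>f = arr_Comp_Suc[OF arrs(1) i k(1,2)] and \<epsilon>'f = arr_Comp_Suc[OF arrs(2) i k(2,1)]
    and f\<eta> = arr_Comp_Suc[OF i arrs(3) k(4,3)] and f\<theta> = arr_Comp_Suc[OF i arrs(4) k(3,4)]
    and l = inv_arr_LUnit[OF f, THEN inv_arr_arr] and l' = inv_arr_LUnit_inv[OF f, THEN inv_arr_arr]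
    and a = inv_arr_Assoc[OF f g f, THEN inv_arr_arr]
    and a' = inv_arr_Assoc_inv[OF f g f, THEN inv_arr_arr]
  note c1 = cancel_inverse[OF Comp_inverse[OF i i arrs(3,4) k(4,3) ii \<eta>\<theta>] f\<eta> f\<theta>
      arr_vcomp[OF a arr_vcomp[OF \<epsilon>'f l']]]
    and c2 = cancel_inverse[OF Assoc_inv_Assoc[OF f g f] a' a arr_vcomp[OF \<epsilon>'f l']]
    and c3 = cancel_inverse[OF Comp_inverse[OF arrs(1,2) i i k(1,2) \<epsilon>\<epsilon>' ii] \<epsilon>f \<epsilon>'f l']
  note v1 = arr_vcomp[OF \<epsilon>'f l'] note v2 = arr_vcomp[OF a v1]
  note v3 = arr_vcomp[OF f\<eta> arr_vcomp[OF f\<theta> v2]]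
  note d1 = equivalent_vcomp_right[OF c1 a' v3 v2]
  note d2 = equivalent_trans[OF d1 c2]
  note d3 = equivalent_vcomp_right[OF d2 \<epsilon>f arr_vcomp[OF a' v3] v1]
  note d4 = equivalent_trans[OF d3 c3]
  note d5 = equivalent_vcomp_right[OF d4 l arr_vcomp[OF \<epsilon>f arr_vcomp[OF a' v3]] l']
  show ?thesis
    unfolding straightened_def by (rule equivalent_trans[OF d5 LUnit_LUnit_inv[OF f]])
qed

lemma isotopic_straightened:
  "isotopic [([f], node_\<eta>, []), ([], node_\<epsilon>', [f, g, f]), ([f], node_\<theta>, [g, f]), ([], node_\<epsilon>, [f])]
     [([], node_\<epsilon>', [f]), ([f], node_\<theta>, []), ([f], node_\<eta>, []), ([], node_\<epsilon>, [f])]"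
  (is "isotopic ?D ?E")
proof -
  let ?M = "[([], node_\<epsilon>', [f]), ([f, g, f], node_\<eta>, []), ([f], node_\<theta>, [g, f]), ([], node_\<epsilon>, [f])]"
  have "exchange ?M ?D"
    using exchange.intros[of "[]" "[]" node_\<epsilon>' "[f]" node_\<eta> "[]"] by simp
  moreover have "exchange ?E ?M"
    using exchange.intros[of "[([], node_\<epsilon>', [f])]" "[f]" node_\<theta> "[]" node_\<eta> "[]"
      "[([], node_\<epsilon>, [f])]"] by simp
  ultimately show ?thesis
    unfolding isotopic_def
    by (meson equivclp_sym equivclp_trans r_into_equivclp)
qed

lemma half_adjoint:
  "\<exists>\<alpha> \<gamma>. inv_arr (Suc n) \<alpha> (f \<cdot>\<^bsub>Suc n\<^esub> g) (Ident G n y) \<and>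
     inv_arr (Suc (Suc n)) \<gamma> (zigzag G (Suc n) f g \<alpha> \<eta>) (Ident G (Suc n) f)"
proof -
  obtain \<alpha> where \<alpha>:
    "rep [([], node_\<epsilon>', [f, g]), ([f], node_\<theta>, [g]), ([], node_\<epsilon>, [])] (Beside F F') Y y y \<alpha>"
    using rep_counit by blast
  have "rep [([f], node_\<eta>, []), ([], node_\<epsilon>', [f, g, f]), ([f], node_\<theta>, [g, f]), ([], node_\<epsilon>, [f])]
      F F x y (zigzag G (Suc n) f g \<alpha> \<eta>)"
    using rep_zigzag[OF \<alpha>] by (simp add: juxtapose_def)
  then have "equivalent (Suc (Suc n)) (zigzag G (Suc n) f g \<alpha> \<eta>) straightened"
    using calculus[OF isotopic_straightened] rep_straightened unfolding rep_def by blast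
  also note straightened_equivalent
  finally show ?thesis
    using rep_eqv[OF \<alpha>] unfolding equivalent_def composites by blast
qed

end

lemma (in hom_calculus) half_adjoint_data:
  assumes f: "arr G n f x y" "bi_closure G (Suc n) f" and objects: "x \<in> Cells H 0" "y \<in> Cells H 0"
  shows "\<exists>f' \<alpha> \<beta> \<gamma>. arr G n f' y x \<and> inv_arr (Suc n) \<alpha> (f \<cdot>\<^bsub>Suc n\<^esub> f') (Ident G n y) \<and>
    inv_arr (Suc n) \<beta> (Ident G n x) (f' \<cdot>\<^bsub>Suc n\<^esub> f) \<and>
    inv_arr (Suc (Suc n)) \<gamma> (zigzag G (Suc n) f f' \<alpha> \<beta>) (Ident G (Suc n) f)"
proof -
  from f have "inv_arr n f x y" by (simp add: inv_arr_def)
  then obtain g where g: "inv_arr n g y x" "equivalent (Suc n) (f \<cdot>\<^bsub>Suc n\<^esub> g) (Ident G n y)"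
    "equivalent (Suc n) (g \<cdot>\<^bsub>Suc n\<^esub> f) (Ident G n x)"
    by (rule inv_arr_inverse)
  then obtain \<epsilon> \<theta> where \<epsilon>: "inv_arr (Suc n) \<epsilon> (f \<cdot>\<^bsub>Suc n\<^esub> g) (Ident G n y)"
    and \<theta>: "inv_arr (Suc n) \<theta> (g \<cdot>\<^bsub>Suc n\<^esub> f) (Ident G n x)"
    by (auto simp: equivalent_def)
  obtain \<epsilon>' where \<epsilon>': "inv_arr (Suc n) \<epsilon>' (Ident G n y) (f \<cdot>\<^bsub>Suc n\<^esub> g)"
    "equivalent (Suc (Suc n)) (\<epsilon> \<cdot>\<^bsub>Suc (Suc n)\<^esub> \<epsilon>') (Ident G (Suc n) (Ident G n y))"
    by (rule inv_arr_inverse[OF \<epsilon>])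
  obtain \<eta> where \<eta>: "inv_arr (Suc n) \<eta> (Ident G n x) (g \<cdot>\<^bsub>Suc n\<^esub> f)"
    "equivalent (Suc (Suc n)) (\<eta> \<cdot>\<^bsub>Suc (Suc n)\<^esub> \<theta>) (Ident G (Suc n) (g \<cdot>\<^bsub>Suc n\<^esub> f))"
    by (rule inv_arr_inverse[OF \<theta>])
  interpret inverse_pair G H n f g x y \<epsilon> \<epsilon>' \<eta> \<theta>
    by unfold_locales (use objects f g \<epsilon> \<theta> \<epsilon>' \<eta> inv_arr_arr in auto)
  show ?thesis using half_adjoint g \<eta> inv_arr_arr by blast
qed

lemma hom_cells_subset: "hom_cells G n x y m \<subseteq> Cells G (n + m + 1)"
  by (cases m) (auto simp: arr_def)

lemma arr_hom: "arr (hom G n x y) m f a b \<Longrightarrow> arr G (n + m + 1) f a b"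
  using hom_cells_subset[of G n x y "Suc m"] by (auto simp: arr_def hom_def)

lemma qi_structure_hom:
  assumes "qi_structure (hom G n x y) m S f"
  shows "qi_structure G (n + m + 1) S f"
proof -
  define X where "X k S f \<longleftrightarrow> (\<exists>m. k = n + m + 1 \<and> qi_structure (hom G n x y) m S f)" for k S f
  have "X (n + m + 1) S f" using assms unfolding X_def by blast
  then show ?thesis
  proof (coinduct rule: qi_structure.coinduct)
    case (qi_structure k S f)
    then obtain m where m: "k = n + m + 1" "qi_structure (hom G n x y) m S f"
      unfolding X_def by blast
    from m(2) show ?case
    proof cases
      case (1 l u v f' R L s t)
      have ops: "Comp (hom G n x y) (Suc l) = Comp G (Suc (n + l + 1))"
        "Ident (hom G n x y) l = Ident G (n + l + 1)" by (simp_all add: hom_def)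
      have "k = Suc (n + l + 1)" using m(1) 1(1) by simp
      moreover have "X (Suc (Suc (n + l + 1))) s R" "X (Suc (Suc (n + l + 1))) t L"
        using 1(7,8) unfolding X_def by (auto intro!: exI[of _ "Suc (Suc l)"])
      moreover have
        "arr G (Suc (n + l + 1)) R (Comp G (Suc (n + l + 1)) 0 f f') (Ident G (n + l + 1) v)"
        "arr G (Suc (n + l + 1)) L (Comp G (Suc (n + l + 1)) 0 f' f) (Ident G (n + l + 1) u)"
        using arr_hom[OF 1(5)] arr_hom[OF 1(6)] unfolding ops by simp_all
      ultimately show ?thesis using 1(2) arr_hom[OF 1(3)] arr_hom[OF 1(4)] by blast
    qed
  qed
qed

lemma higher_precategory_hom_calculus:
  assumes G: "higher_precategory G" and f: "arr G n f x y"
  obtains H where "hom_calculus G H n" "x \<in> Cells H 0" "y \<in> Cells H 0"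
proof -
  interpret precategory G
    using G by unfold_locales (auto simp: higher_precategory_def)
  have calculus: "equivalent k s t" if "arr G k h s t" "qi_structure G (Suc k) S h" for k h s t S
    using that inv_arrI_structure equivalentI by blast
  show thesis
  proof (cases n)
    case 0
    have "hom_calculus G G n"
    proof unfold_locales
      show "equivalent (Suc (Suc n)) s t"
        if "isotopic D E" "represents G D b c s" "represents G E b c t" for D E b c s t
        using G that calculus 0 unfolding higher_precategory_def respects_graphical_calculus_def
        by (metis One_nat_def Suc_1 numeral_3_eq_3)
    qed (simp_all add: 0)
    with that f 0 arr_cells show thesis by blast
  next
    case (Suc p)
    let ?H = "hom G p (Src G p x) (Tgt G p x)"
    have parallel: "parallel G p (Src G p x) (Tgt G p x)"
      using globular_set_ic arr_cells[OF f] Suc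
      by (auto simp: parallel_def globular_set_ic_def globular_set_def)
    have "hom_calculus G ?H n"
    proof unfold_locales
      show "equivalent (Suc (Suc n)) s t"
        if rep: "isotopic D E" "represents ?H D b c s" "represents ?H E b c t" for D E b c s t
      proof -
        from G parallel have "respects_graphical_calculus ?H"
          by (simp add: higher_precategory_def)
        with rep obtain h S where h: "arr ?H 2 h s t" "qi_structure ?H 3 S h"
          unfolding respects_graphical_calculus_def by blast
        have "arr G (Suc (Suc n)) h s t"
          using h(1) hom_cells_subset[of G p "Src G p x" "Tgt G p x" 3] Suc
          by (auto simp: arr_def hom_def numeral_2_eq_2 numeral_3_eq_3)
        moreover have "qi_structure G (Suc (Suc (Suc n))) S h"
          using qi_structure_hom[OF h(2)] Suc by (simp add: numeral_3_eq_3)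
        ultimately show ?thesis by (rule calculus)
      qed
    qed (auto simp: Suc hom_def arr_def)
    moreover have "x \<in> Cells ?H 0" "y \<in> Cells ?H 0"
      using globular_set_ic arr_cells[OF f] f Suc
      by (auto simp: hom_def arr_def globular_set_ic_def globular_set_def)
    ultimately show thesis by (rule that)
  qed
qed

lemma quasi_invertible_imp_half_adjoint_invertible:
  assumes G: "higher_precategory G" and f: "quasi_invertible G n f"
  shows "half_adjoint_invertible G n f"
proof -
  interpret precategory G
    using G by unfold_locales (auto simp: higher_precategory_def)
  show ?thesis
  proof (rule half_adjoint_invertible_coinduct[where X = "bi_closure G"])
    show "bi_closure G n f" using f by (rule bi_closure_quasi_invertible)
  next
    fix n f assume f: "bi_closure G n f"
    then obtain m x y where m: "n = Suc m" "arr G m f x y"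
      using bi_closure_step by blast
    obtain H where "hom_calculus G H m" "x \<in> Cells H 0" "y \<in> Cells H 0"
      by (rule higher_precategory_hom_calculus[OF G m(2)])
    then show "\<exists>m x y f' \<alpha> \<beta> \<gamma>. n = Suc m \<and> arr G m f x y \<and> arr G m f' y x \<and>
      arr G (Suc m) \<alpha> (f \<cdot>\<^bsub>Suc m\<^esub> f') (Ident G m y) \<and>
      arr G (Suc m) \<beta> (Ident G m x) (f' \<cdot>\<^bsub>Suc m\<^esub> f) \<and>
      arr G (Suc (Suc m)) \<gamma> (zigzag G (Suc m) f f' \<alpha> \<beta>) (Ident G (Suc m) f) \<and>
      bi_closure G (Suc n) \<alpha> \<and> bi_closure G (Suc n) \<beta> \<and> bi_closure G (Suc (Suc n)) \<gamma>"
      using hom_calculus.half_adjoint_data[of G H m f x y] m f unfolding inv_arr_def by fast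
  qed
qed

theorem corollary19:
  fixes G :: "'c precat" and n :: nat and f :: 'c
  assumes "higher_precategory G" and "n > 0" and "f \<in> Cells G n"
  shows "((\<exists>S. bi_structure G n S f) \<longleftrightarrow> (\<exists>S. qi_structure G n S f)) \<and>
         ((\<exists>S. qi_structure G n S f) \<longleftrightarrow> (\<exists>S. hai_structure G n S f))"
proof -
  interpret precategory G
    using assms(1) by unfold_locales (auto simp: higher_precategory_def)
  have "bi_invertible G n f \<longleftrightarrow> quasi_invertible G n f"
    by (rule iffI[OF bi_closure_imp_quasi_invertible[OF bi_closure_base]
        quasi_invertible_imp_bi_invertible])
  moreover have "quasi_invertible G n f \<longleftrightarrow> half_adjoint_invertible G n f"
    by (rule iffI[OF quasi_invertible_imp_half_adjoint_invertible[OF assms(1)]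
        half_adjoint_invertible_imp_quasi_invertible])
  ultimately show ?thesis
    by (simp add: bi_invertible_def quasi_invertible_def half_adjoint_invertible_def)
qed

end
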